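(* Let $M_{\mathcal T}$ be Tsirelson's space (in the form of Figiel and Johnson) and let $\phi(x,y)=\|x+y\|$. Then: (i) $M_{\mathcal T}$ has NIP, i.e. the formula $\phi$ has NIP on $M_{\mathcal T}$. (ii) The space of definable predicates on $M_{\mathcal T}$ is not weakly sequentially complete.
   Context: **Tsirelson's space.** Let $c_{00}$ be the space of finitely supported real sequences. For finite sets $E,F\subseteq\mathbb N$, $E<F$ means $\max E<\min F$, and $n\leqslant E$ means $n\leqslant\min E$. A family $(E_i)_{i=1}^n$ of finite subsets of $\mathbb N$ is admissible if $n\leqslant E_1<E_2<\cdots<E_n$. $Ex$ is the restriction of $x$ to $E$ (equal to $x(k)$ for $k\in E$, $0$ otherwise). Put $\|x\|_0=\|x\|_\infty$ and $\|x\|_{n+1}=\max\big(\|x\|_n,\ \sup\{\frac12\sum_{i=1}^k\|E_ix\|_n : k\geqslant 1,\ (E_i)_{i=1}^k \text{ admissible}\}\big)$, and $\|x\|=\lim_n\|x\|_n$. Then $M_{\mathcal T}$ is the completion of $(c_{00},\|\cdot\|)$. **Convention.** A Banach space is regarded as a structure of continuous logic by means of its unit ball: elements $a,b\in M$ below range over the unit ball, so $\phi(x,y)=\|x+y\|$ takes values in $[0,2]$. **NIP.** $\phi(x,y)$ has the independence property (IP) on $M$ if there are a sequence $(a_n)\subseteq M$ and reals $r>s$ such that for all finite disjoint $E,F\subseteq\mathbb N$ there is $b\in M$ with $\phi(a_n,b)\leqslant s$ for all $n\in E$ and $\phi(a_n,b)\geqslant r$ for all $n\in F$. Otherwise $\phi$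 has NIP on $M$. **Weak sequential completeness.** Let $\tilde\phi(y,x)=\phi(x,y)$ and let $X=S_{\tilde\phi}(M)$ be the compact space of complete $\tilde\phi$-types over $M$; it can be identified with the closure in $[0,2]^{M}$ (product topology) of the set of functions $f_b:M\to[0,2]$, $f_b(x)=\|x+b\|$, $b\in M$. For $a\in M$ let $\phi(a,y):X\to[0,2]$ be the continuous function $q\mapsto\phi(a,q)$ (evaluation of $q$ at $a$). The space of definable predicates on $M$ is weakly sequentially complete if the limit of every pointwise convergent (on $X$) sequence from $\{\phi(a,y):X\to[0,2] : a\in M\}$ is continuous on $X$. *)

theory Defs
  imports "HOL-Analysis.Analysis"
begin

section \<open>The norms on finitely supported sequences\<close>

definition finsupp :: "(nat \<Rightarrow> real) \<Rightarrow> bool" where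
  "finsupp x \<longleftrightarrow> finite {k. x k \<noteq> 0}"

definition restr :: "nat set \<Rightarrow> (nat \<Rightarrow> real) \<Rightarrow> nat \<Rightarrow> real" where
  "restr E x = (\<lambda>k. if k \<in> E then x k else 0)"

text \<open>The members are \<open>E 0, \<dots>, E (n - 1)\<close>. They are required to be nonempty, so that
  \<open>Max\<close> and \<open>Min\<close> are meaningful; empty members would contribute \<open>0\<close> to the sums below.\<close>

definition admissible :: "nat \<Rightarrow> (nat \<Rightarrow> nat set) \<Rightarrow> bool" where
  "admissible n E \<longleftrightarrow>
     (\<forall>i<n. finite (E i) \<and> E i \<noteq> {}) \<and>
     n \<le> Min (E 0) \<and>
     (\<forall>i. Suc i < n \<longrightarrow> Max (E i) < Min (E (Suc i)))"

primrec tnorm :: "nat \<Rightarrow> (nat \<Rightarrow> real) \<Rightarrow> real" where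
  "tnorm 0 x = (SUP k. \<bar>x k\<bar>)"
| "tnorm (Suc n) x =
     max (tnorm n x)
         (Sup {(1/2) * (\<Sum>i<k. tnorm n (restr (E i) x)) | k E. 1 \<le> k \<and> admissible k E})"

definition tsirelson_norm :: "(nat \<Rightarrow> real) \<Rightarrow> real" where
  "tsirelson_norm x = lim (\<lambda>n. tnorm n x)"

lemma finsupp_restr: "finsupp x \<Longrightarrow> finsupp (restr E x)"
  unfolding finsupp_def restr_def by (rule finite_subset[rotated]) auto

lemma finsupp_zero: "finsupp (\<lambda>k. 0)"
  by (simp add: finsupp_def)

lemma finsupp_add: "finsupp x \<Longrightarrow> finsupp y \<Longrightarrow> finsupp (\<lambda>k. x k + y k)"
  unfolding finsupp_def
  by (rule finite_subset[of _ "{k. x k \<noteq> 0} \<union> {k. y k \<noteq> 0}"]) auto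

lemma finsupp_scale: "finsupp x \<Longrightarrow> finsupp (\<lambda>k. c * x k)"
  unfolding finsupp_def by (rule finite_subset[rotated]) auto

lemma restr_add: "restr E (\<lambda>k. x k + y k) = (\<lambda>k. restr E x k + restr E y k)"
  by (auto simp: restr_def)

lemma restr_scale: "restr E (\<lambda>k. c * x k) = (\<lambda>k. c * restr E x k)"
  by (auto simp: restr_def)

lemma admissible_disjoint:
  assumes "admissible n E" "i < n" "j < n" "i \<noteq> j"
  shows "E i \<inter> E j = {}"
proof -
  have E: "finite (E i)" "E i \<noteq> {}" if "i < n" for i
    using assms(1) that by (auto simp: admissible_def)
  have step: "Max (E i) < Min (E (Suc i))" if "Suc i < n" for i
    using assms(1) that by (auto simp: admissible_def)
  have less: "Max (E i) < Min (E (Suc (i + d)))" if "Suc (i + d) < n" for i d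
    using that
  proof (induction d)
    case 0
    then show ?case using step by simp
  next
    case (Suc d)
    have "Max (E i) < Min (E (Suc (i + d)))"
      using Suc by simp
    also have "\<dots> \<le> Max (E (Suc (i + d)))"
      using E[of "Suc (i + d)"] Suc.prems by simp
    also have "\<dots> < Min (E (Suc (i + Suc d)))"
      using step[of "Suc (i + d)"] Suc.prems by simp
    finally show ?case .
  qed
  have main: "E i \<inter> E j = {}" if "i < j" "j < n" for i j
  proof -
    obtain d where d: "j = Suc (i + d)"
      using \<open>i < j\<close> less_imp_Suc_add by blast
    have lt: "Max (E i) < Min (E j)"
      using less[of i d] that d by simp
    show ?thesis
    proof (rule ccontr)
      assume "E i \<inter> E j \<noteq> {}"
      then obtain m where m: "m \<in> E i" "m \<in> E j" by blast
      have "m \<le> Max (E i)" "Min (E j) \<le> m"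
        using E[of i] E[of j] m that by auto
      with lt show False by simp
    qed
  qed
  show ?thesis
    using main[of i j] main[of j i] assms by (cases "i < j") (auto simp: Int_commute)
qed

lemma admissible_ex: "\<exists>k E. 1 \<le> k \<and> admissible k E"
  by (rule exI[of _ 1], rule exI[of _ "\<lambda>_. {1}"]) (simp add: admissible_def)

definition l1norm :: "(nat \<Rightarrow> real) \<Rightarrow> real" where
  "l1norm x = (\<Sum>k | x k \<noteq> 0. \<bar>x k\<bar>)"

lemma l1norm_nonneg: "0 \<le> l1norm x"
  by (simp add: l1norm_def sum_nonneg)

lemma abs_le_l1norm:
  assumes "finsupp x"
  shows "\<bar>x k\<bar> \<le> l1norm x"
proof (cases "x k = 0")
  case True
  then show ?thesis by (simp add: l1norm_nonneg)
next
  case False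
  then show ?thesis
    using assms unfolding l1norm_def finsupp_def
    by (intro member_le_sum[of k _ "\<lambda>k. \<bar>x k\<bar>"]) auto
qed

lemma l1norm_restr_sum:
  assumes x: "finsupp x" and E: "admissible n E"
  shows "(\<Sum>i<n. l1norm (restr (E i) x)) \<le> l1norm x"
proof -
  let ?A = "{k. x k \<noteq> 0}"
  have fin: "finite ?A" using x by (simp add: finsupp_def)
  have "l1norm (restr (E i) x) = (\<Sum>k\<in>E i \<inter> ?A. \<bar>x k\<bar>)" for i
  proof -
    have "{k. restr (E i) x k \<noteq> 0} = E i \<inter> ?A"
      by (auto simp: restr_def)
    then show ?thesis by (simp add: l1norm_def restr_def)
  qed
  then have "(\<Sum>i<n. l1norm (restr (E i) x)) = (\<Sum>i<n. \<Sum>k\<in>E i \<inter> ?A. \<bar>x k\<bar>)"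
    by simp
  also have "\<dots> = (\<Sum>k\<in>(\<Union>i\<in>{..<n}. E i \<inter> ?A). \<bar>x k\<bar>)"
    using fin admissible_disjoint[OF E] by (intro sum.UNION_disjoint[symmetric]) blast+
  also have "\<dots> \<le> l1norm x"
    unfolding l1norm_def using fin by (intro sum_mono2) auto
  finally show ?thesis .
qed

lemma tnorm_bounds: "finsupp x \<Longrightarrow> 0 \<le> tnorm n x \<and> tnorm n x \<le> l1norm x"
proof (induction n arbitrary: x)
  case 0
  have bdd: "bdd_above (range (\<lambda>k. \<bar>x k\<bar>))"
    using abs_le_l1norm[OF 0] by (auto intro!: bdd_aboveI)
  have "0 \<le> \<bar>x 0\<bar>" by simp
  also have "\<dots> \<le> tnorm 0 x"
    unfolding tnorm.simps by (rule cSUP_upper[OF UNIV_I bdd])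
  finally show ?case
    using abs_le_l1norm[OF 0] by (auto intro!: cSUP_least)
next
  case (Suc n)
  let ?S = "{(1/2) * (\<Sum>i<k. tnorm n (restr (E i) x)) | k E. 1 \<le> k \<and> admissible k E}"
  have "s \<le> l1norm x" if s_in: "s \<in> ?S" for s
  proof -
    obtain k E where s: "s = (1/2) * (\<Sum>i<k. tnorm n (restr (E i) x))" "admissible k E"
      using s_in by blast
    have "(\<Sum>i<k. tnorm n (restr (E i) x)) \<le> (\<Sum>i<k. l1norm (restr (E i) x))"
      using Suc by (intro sum_mono) (auto simp: finsupp_restr)
    also have "\<dots> \<le> l1norm x"
      by (rule l1norm_restr_sum[OF Suc.prems s(2)])
    finally show ?thesis using s l1norm_nonneg[of x] by simp
  qed
  moreover have "?S \<noteq> {}" using admissible_ex by blast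
  ultimately have "Sup ?S \<le> l1norm x" by (intro cSup_least) auto
  then show ?case using Suc.IH[OF Suc.prems] by (auto simp: le_max_iff_disj)
qed

lemma tnorm_family_le_Suc:
  assumes x: "finsupp x" and k: "1 \<le> k" and E: "admissible k E"
  shows "(1/2) * (\<Sum>i<k. tnorm n (restr (E i) x)) \<le> tnorm (Suc n) x"
proof -
  let ?S = "{(1/2) * (\<Sum>i<k. tnorm n (restr (E i) x)) | k E. 1 \<le> k \<and> admissible k E}"
  have "bdd_above ?S"
  proof (rule bdd_aboveI[of _ "l1norm x"])
    fix s assume "s \<in> ?S"
    then obtain k E where s: "s = (1/2) * (\<Sum>i<k. tnorm n (restr (E i) x))" "admissible k E"
      by blast
    have "(\<Sum>i<k. tnorm n (restr (E i) x)) \<le> (\<Sum>i<k. l1norm (restr (E i) x))"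
      using tnorm_bounds[OF finsupp_restr[OF x]] by (intro sum_mono) auto
    also have "\<dots> \<le> l1norm x"
      by (rule l1norm_restr_sum[OF x s(2)])
    finally show "s \<le> l1norm x" using s l1norm_nonneg[of x] by simp
  qed
  then have "(1/2) * (\<Sum>i<k. tnorm n (restr (E i) x)) \<le> Sup ?S"
    by (rule cSup_upper[rotated]) (use k E in blast)
  then show ?thesis by simp
qed

lemma tnorm_Suc_least:
  assumes "tnorm n x \<le> c"
    and "\<And>k E. 1 \<le> k \<Longrightarrow> admissible k E \<Longrightarrow> (1/2) * (\<Sum>i<k. tnorm n (restr (E i) x)) \<le> c"
  shows "tnorm (Suc n) x \<le> c"
proof -
  let ?S = "{(1/2) * (\<Sum>i<k. tnorm n (restr (E i) x)) | k E. 1 \<le> k \<and> admissible k E}"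
  have "?S \<noteq> {}" using admissible_ex by blast
  then have "Sup ?S \<le> c" using assms(2) by (intro cSup_least) blast+
  then show ?thesis using assms(1) by simp
qed

lemma abs_le_tnorm:
  assumes "finsupp x"
  shows "\<bar>x k\<bar> \<le> tnorm 0 x"
proof -
  have "bdd_above (range (\<lambda>k. \<bar>x k\<bar>))"
    using abs_le_l1norm[OF assms] by (auto intro!: bdd_aboveI)
  then show ?thesis unfolding tnorm.simps by (rule cSUP_upper[OF UNIV_I])
qed

lemma tnorm_mono: "incseq (\<lambda>n. tnorm n x)"
  by (rule incseq_SucI) simp

lemma tnorm_triangle:
  "finsupp x \<Longrightarrow> finsupp y \<Longrightarrow> tnorm n (\<lambda>k. x k + y k) \<le> tnorm n x + tnorm n y"
proof (induction n arbitrary: x y)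
  case 0
  have "\<bar>x k + y k\<bar> \<le> tnorm 0 x + tnorm 0 y" for k
    using abs_le_tnorm[OF 0(1), of k] abs_le_tnorm[OF 0(2), of k] by linarith
  then show ?case by (auto intro!: cSUP_least)
next
  case (Suc n)
  show ?case
  proof (rule tnorm_Suc_least)
    have "tnorm n (\<lambda>k. x k + y k) \<le> tnorm n x + tnorm n y"
      using Suc by blast
    also have "\<dots> \<le> tnorm (Suc n) x + tnorm (Suc n) y"
      by (intro add_mono) simp_all
    finally show "tnorm n (\<lambda>k. x k + y k) \<le> tnorm (Suc n) x + tnorm (Suc n) y" .
  next
    fix k :: nat and E assume k: "1 \<le> k" and E: "admissible k E"
    have "(1/2) * (\<Sum>i<k. tnorm n (restr (E i) (\<lambda>k. x k + y k)))
      \<le> (1/2) * (\<Sum>i<k. tnorm n (restr (E i) x) + tnorm n (restr (E i) y))"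
      unfolding restr_add using Suc
      by (intro mult_left_mono sum_mono) (auto simp: finsupp_restr)
    also have "\<dots> = (1/2) * (\<Sum>i<k. tnorm n (restr (E i) x))
      + (1/2) * (\<Sum>i<k. tnorm n (restr (E i) y))"
      by (simp add: sum.distrib)
    also have "\<dots> \<le> tnorm (Suc n) x + tnorm (Suc n) y"
      using Suc.prems k E by (intro add_mono tnorm_family_le_Suc)
    finally show "(1/2) * (\<Sum>i<k. tnorm n (restr (E i) (\<lambda>k. x k + y k)))
      \<le> tnorm (Suc n) x + tnorm (Suc n) y" .
  qed
qed

lemma tnorm_scale_le: "finsupp x \<Longrightarrow> tnorm n (\<lambda>k. c * x k) \<le> \<bar>c\<bar> * tnorm n x"
proof (induction n arbitrary: x)
  case 0
  have "\<bar>c * x k\<bar> \<le> \<bar>c\<bar> * tnorm 0 x" for k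
    using abs_le_tnorm[OF 0, of k] by (simp add: abs_mult mult_left_mono)
  then show ?case by (auto intro!: cSUP_least)
next
  case (Suc n)
  show ?case
  proof (rule tnorm_Suc_least)
    have "tnorm n (\<lambda>k. c * x k) \<le> \<bar>c\<bar> * tnorm n x"
      using Suc by blast
    also have "\<dots> \<le> \<bar>c\<bar> * tnorm (Suc n) x"
      by (intro mult_left_mono) simp_all
    finally show "tnorm n (\<lambda>k. c * x k) \<le> \<bar>c\<bar> * tnorm (Suc n) x" .
  next
    fix k :: nat and E assume k: "1 \<le> k" and E: "admissible k E"
    have "(1/2) * (\<Sum>i<k. tnorm n (restr (E i) (\<lambda>k. c * x k)))
      \<le> (1/2) * (\<Sum>i<k. \<bar>c\<bar> * tnorm n (restr (E i) x))"
      unfolding restr_scale using Suc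
      by (intro mult_left_mono sum_mono) (auto simp: finsupp_restr)
    also have "\<dots> = \<bar>c\<bar> * ((1/2) * (\<Sum>i<k. tnorm n (restr (E i) x)))"
      by (simp add: sum_distrib_left)
    also have "\<dots> \<le> \<bar>c\<bar> * tnorm (Suc n) x"
      using Suc.prems k E by (intro mult_left_mono tnorm_family_le_Suc) auto
    finally show "(1/2) * (\<Sum>i<k. tnorm n (restr (E i) (\<lambda>k. c * x k)))
      \<le> \<bar>c\<bar> * tnorm (Suc n) x" .
  qed
qed

lemma tsirelson_norm_LIMSEQ:
  assumes "finsupp x"
  shows "(\<lambda>n. tnorm n x) \<longlonglongrightarrow> tsirelson_norm x"
proof -
  obtain L where "(\<lambda>n. tnorm n x) \<longlonglongrightarrow> L"
    using incseq_convergent[OF tnorm_mono[of x], of "l1norm x"] tnorm_bounds[OF assms] by blast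
  then show ?thesis by (simp add: tsirelson_norm_def limI)
qed

lemma abs_le_tsirelson_norm:
  assumes "finsupp x"
  shows "\<bar>x k\<bar> \<le> tsirelson_norm x"
  using abs_le_tnorm[OF assms, of k] incseq_le[OF tnorm_mono tsirelson_norm_LIMSEQ[OF assms], of 0]
  by simp

lemma tsirelson_norm_triangle:
  assumes "finsupp x" "finsupp y"
  shows "tsirelson_norm (\<lambda>k. x k + y k) \<le> tsirelson_norm x + tsirelson_norm y"
  by (rule LIMSEQ_le[OF tsirelson_norm_LIMSEQ[OF finsupp_add[OF assms]]
        tendsto_add[OF tsirelson_norm_LIMSEQ[OF assms(1)] tsirelson_norm_LIMSEQ[OF assms(2)]]])
    (use tnorm_triangle[OF assms] in blast)

lemma tsirelson_norm_scale_le: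
  assumes "finsupp x"
  shows "tsirelson_norm (\<lambda>k. c * x k) \<le> \<bar>c\<bar> * tsirelson_norm x"
  by (rule LIMSEQ_le[OF tsirelson_norm_LIMSEQ[OF finsupp_scale[OF assms]]
        tendsto_mult_left[OF tsirelson_norm_LIMSEQ[OF assms]]])
    (use tnorm_scale_le[OF assms] in blast)

lemma tsirelson_norm_zero: "tsirelson_norm (\<lambda>k. 0) = 0"
  using tsirelson_norm_scale_le[OF finsupp_zero, of 0] abs_le_tsirelson_norm[OF finsupp_zero]
  by simp

lemma tsirelson_norm_scale:
  assumes "finsupp x"
  shows "tsirelson_norm (\<lambda>k. c * x k) = \<bar>c\<bar> * tsirelson_norm x"
proof (cases "c = 0")
  case True
  then show ?thesis by (simp add: tsirelson_norm_zero)
next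
  case False
  have "tsirelson_norm (\<lambda>k. inverse c * (c * x k)) \<le> \<bar>inverse c\<bar> * tsirelson_norm (\<lambda>k. c * x k)"
    by (rule tsirelson_norm_scale_le[OF finsupp_scale[OF assms]])
  moreover have "(\<lambda>k. inverse c * (c * x k)) = x"
    using False by auto
  ultimately have "\<bar>c\<bar> * tsirelson_norm x \<le> tsirelson_norm (\<lambda>k. c * x k)"
    using False by (simp add: field_simps)
  then show ?thesis
    using tsirelson_norm_scale_le[OF assms, of c] by linarith
qed


section \<open>The space \<open>c\<^sub>0\<^sub>0\<close> with the Tsirelson norm\<close>

text \<open>Sequences are indexed by the positive integers, so coordinate \<open>0\<close> is a dummy one. (With
  a genuine coordinate \<open>0\<close>, which lies in no set of an admissible family, one would get the
  \<open>\<infinity>\<close>-sum of Tsirelson's space with the real line.)\<close>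

typedef tsirelson_c00 = "{x. finsupp x \<and> x 0 = 0}"
  morphisms coord Abs_c00
  by (rule exI[of _ "\<lambda>k. 0"]) (simp add: finsupp_zero)

setup_lifting type_definition_tsirelson_c00

instantiation tsirelson_c00 :: real_normed_vector
begin

lift_definition zero_tsirelson_c00 :: tsirelson_c00 is "\<lambda>k. 0"
  by (simp add: finsupp_zero)

lift_definition plus_tsirelson_c00 :: "tsirelson_c00 \<Rightarrow> tsirelson_c00 \<Rightarrow> tsirelson_c00"
  is "\<lambda>x y k. x k + y k"
  by (simp add: finsupp_add)

lift_definition scaleR_tsirelson_c00 :: "real \<Rightarrow> tsirelson_c00 \<Rightarrow> tsirelson_c00"
  is "\<lambda>c x k. c * x k"
  by (simp add: finsupp_scale)

definition uminus_tsirelson_c00 :: "tsirelson_c00 \<Rightarrow> tsirelson_c00" where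
  "uminus_tsirelson_c00 x = (-1) *\<^sub>R x"

definition minus_tsirelson_c00 :: "tsirelson_c00 \<Rightarrow> tsirelson_c00 \<Rightarrow> tsirelson_c00" where
  "minus_tsirelson_c00 x y = x + (-1) *\<^sub>R y"

lift_definition norm_tsirelson_c00 :: "tsirelson_c00 \<Rightarrow> real" is tsirelson_norm .

definition dist_tsirelson_c00 :: "tsirelson_c00 \<Rightarrow> tsirelson_c00 \<Rightarrow> real" where
  "dist_tsirelson_c00 x y = norm (x - y)"

definition sgn_tsirelson_c00 :: "tsirelson_c00 \<Rightarrow> tsirelson_c00" where
  "sgn_tsirelson_c00 x = inverse (norm x) *\<^sub>R x"

definition uniformity_tsirelson_c00 :: "(tsirelson_c00 \<times> tsirelson_c00) filter" where
  "uniformity_tsirelson_c00 = (INF e\<in>{0<..}. principal {(x, y). dist x y < e})"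

definition open_tsirelson_c00 :: "tsirelson_c00 set \<Rightarrow> bool" where
  "open_tsirelson_c00 U \<longleftrightarrow> (\<forall>x\<in>U. eventually (\<lambda>(x', y). x' = x \<longrightarrow> y \<in> U) uniformity)"

instance
proof
  fix x y z :: tsirelson_c00 and a b :: real
  show "x + y + z = x + (y + z)" by transfer (simp add: add.assoc)
  show "x + y = y + x" by transfer (simp add: add.commute)
  show "0 + x = x" by transfer simp
  show "- x + x = 0" unfolding uminus_tsirelson_c00_def by transfer simp
  show "x - y = x + - y" by (simp add: minus_tsirelson_c00_def uminus_tsirelson_c00_def)
  show "a *\<^sub>R (x + y) = a *\<^sub>R x + a *\<^sub>R y" by transfer (simp add: distrib_left)
  show "(a + b) *\<^sub>R x = a *\<^sub>R x + b *\<^sub>R x" by transfer (simp add: distrib_right)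
  show "a *\<^sub>R b *\<^sub>R x = (a * b) *\<^sub>R x" by transfer (simp add: mult.assoc)
  show "1 *\<^sub>R x = x" by transfer simp
  show "norm x = 0 \<longleftrightarrow> x = 0"
  proof transfer
    fix x :: "nat \<Rightarrow> real" assume "finsupp x \<and> x 0 = 0"
    then have x: "finsupp x" by simp
    have "x = (\<lambda>k. 0)" if "tsirelson_norm x = 0"
      using abs_le_tsirelson_norm[OF x] that by (auto simp: fun_eq_iff)
    then show "tsirelson_norm x = 0 \<longleftrightarrow> x = (\<lambda>k. 0)"
      using tsirelson_norm_zero by blast
  qed
  show "norm (x + y) \<le> norm x + norm y" by transfer (simp add: tsirelson_norm_triangle)
  show "norm (a *\<^sub>R x) = \<bar>a\<bar> * norm x" by transfer (simp add: tsirelson_norm_scale)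
  show "dist x y = norm (x - y)" by (rule dist_tsirelson_c00_def)
  show "sgn x = inverse (norm x) *\<^sub>R x" by (rule sgn_tsirelson_c00_def)
  show "uniformity = (INF e\<in>{0<..}. principal {(x :: tsirelson_c00, y). dist x y < e})"
    by (rule uniformity_tsirelson_c00_def)
  show "open U \<longleftrightarrow> (\<forall>x\<in>U. \<forall>\<^sub>F (x', y) in uniformity. x' = x \<longrightarrow> y \<in> U)"
    for U :: "tsirelson_c00 set" by (rule open_tsirelson_c00_def)
qed

end


section \<open>The completion of a normed space\<close>

definition cauchy_equiv :: "(nat \<Rightarrow> 'a::real_normed_vector) \<Rightarrow> (nat \<Rightarrow> 'a) \<Rightarrow> bool" where
  "cauchy_equiv X Y \<longleftrightarrow> Cauchy X \<and> Cauchy Y \<and> (\<lambda>n. X n - Y n) \<longlonglongrightarrow> 0"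

lemma cauchy_equiv_part_equivp: "part_equivp (cauchy_equiv :: (nat \<Rightarrow> 'a::real_normed_vector) \<Rightarrow> _)"
proof (rule part_equivpI)
  show "\<exists>X :: nat \<Rightarrow> 'a. cauchy_equiv X X"
    by (rule exI[of _ "\<lambda>_. 0"]) (simp add: cauchy_equiv_def convergent_Cauchy convergent_const)
  show "symp (cauchy_equiv :: (nat \<Rightarrow> 'a) \<Rightarrow> _)"
  proof (rule sympI)
    fix X Y :: "nat \<Rightarrow> 'a" assume *: "cauchy_equiv X Y"
    then have "(\<lambda>n. - (X n - Y n)) \<longlonglongrightarrow> - 0"
      unfolding cauchy_equiv_def by (intro tendsto_minus) simp
    with * show "cauchy_equiv Y X" by (simp add: cauchy_equiv_def)
  qed
  show "transp (cauchy_equiv :: (nat \<Rightarrow> 'a) \<Rightarrow> _)"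
  proof (rule transpI)
    fix X Y Z :: "nat \<Rightarrow> 'a" assume *: "cauchy_equiv X Y" "cauchy_equiv Y Z"
    then have "(\<lambda>n. (X n - Y n) + (Y n - Z n)) \<longlonglongrightarrow> 0 + 0"
      unfolding cauchy_equiv_def by (intro tendsto_add) simp_all
    with * show "cauchy_equiv X Z" by (simp add: cauchy_equiv_def)
  qed
qed

quotient_type (overloaded) 'a completion =
  "nat \<Rightarrow> 'a::real_normed_vector" / partial: cauchy_equiv
  by (rule cauchy_equiv_part_equivp)

lemma cauchy_equiv_refl_iff: "cauchy_equiv X X \<longleftrightarrow> Cauchy X"
  by (simp add: cauchy_equiv_def)

lemma Cauchy_convergent_norm:
  fixes X :: "nat \<Rightarrow> 'a::real_normed_vector"
  assumes "Cauchy X"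
  shows "(\<lambda>n. norm (X n)) \<longlonglongrightarrow> lim (\<lambda>n. norm (X n))"
proof -
  have "Cauchy (\<lambda>n. norm (X n))"
  proof (rule metric_CauchyI)
    fix e :: real assume "e > 0"
    then obtain M where M: "\<forall>m\<ge>M. \<forall>n\<ge>M. dist (X m) (X n) < e"
      using assms metric_CauchyD by blast
    have "dist (norm (X m)) (norm (X n)) < e" if "m \<ge> M" "n \<ge> M" for m n
      using M that norm_triangle_ineq3[of "X m" "X n"]
      by (smt (verit) dist_norm dist_real_def real_norm_def)
    then show "\<exists>M. \<forall>m\<ge>M. \<forall>n\<ge>M. dist (norm (X m)) (norm (X n)) < e" by blast
  qed
  then show ?thesis
    by (simp add: Cauchy_convergent flip: convergent_LIMSEQ_iff)
qed

lemma Cauchy_add: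
  fixes X Y :: "nat \<Rightarrow> 'a::real_normed_vector"
  assumes "Cauchy X" "Cauchy Y"
  shows "Cauchy (\<lambda>n. X n + Y n)"
proof (rule metric_CauchyI)
  fix e :: real assume "0 < e"
  then have "0 < e / 2" by simp
  obtain M where M: "\<forall>m\<ge>M. \<forall>n\<ge>M. dist (X m) (X n) < e / 2"
    using metric_CauchyD[OF assms(1) \<open>0 < e / 2\<close>] by blast
  obtain N where N: "\<forall>m\<ge>N. \<forall>n\<ge>N. dist (Y m) (Y n) < e / 2"
    using metric_CauchyD[OF assms(2) \<open>0 < e / 2\<close>] by blast
  have "dist (X m + Y m) (X n + Y n) < e" if "m \<ge> max M N" "n \<ge> max M N" for m n
  proof -
    have "dist (X m) (X n) < e / 2" "dist (Y m) (Y n) < e / 2"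
      using M N that by auto
    then show ?thesis
      using dist_triangle_add[of "X m" "Y m" "X n" "Y n"] by linarith
  qed
  then show "\<exists>M. \<forall>m\<ge>M. \<forall>n\<ge>M. dist (X m + Y m) (X n + Y n) < e" by blast
qed

lemma Cauchy_scaleR:
  fixes X :: "nat \<Rightarrow> 'a::real_normed_vector"
  assumes "Cauchy X"
  shows "Cauchy (\<lambda>n. c *\<^sub>R X n)"
  using bounded_linear.Cauchy[OF bounded_linear_scaleR_right assms] .

instantiation completion :: (real_normed_vector) real_normed_vector
begin

lift_definition zero_completion :: "'a completion" is "\<lambda>_. 0"
  by (simp add: cauchy_equiv_refl_iff convergent_Cauchy convergent_const)

lift_definition plus_completion :: "'a completion \<Rightarrow> 'a completion \<Rightarrow> 'a completion"
  is "\<lambda>X Y n. X n + Y n"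
proof -
  fix X X' Y Y' :: "nat \<Rightarrow> 'a"
  assume *: "cauchy_equiv X X'" "cauchy_equiv Y Y'"
  then have "(\<lambda>n. (X n - X' n) + (Y n - Y' n)) \<longlonglongrightarrow> 0 + 0"
    unfolding cauchy_equiv_def by (intro tendsto_add) simp_all
  with * show "cauchy_equiv (\<lambda>n. X n + Y n) (\<lambda>n. X' n + Y' n)"
    by (simp add: cauchy_equiv_def Cauchy_add algebra_simps)
qed

lift_definition scaleR_completion :: "real \<Rightarrow> 'a completion \<Rightarrow> 'a completion"
  is "\<lambda>c X n. c *\<^sub>R X n"
proof -
  fix c and X X' :: "nat \<Rightarrow> 'a"
  assume *: "cauchy_equiv X X'"
  then have "(\<lambda>n. c *\<^sub>R (X n - X' n)) \<longlonglongrightarrow> c *\<^sub>R 0"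
    unfolding cauchy_equiv_def by (intro tendsto_scaleR tendsto_const) simp_all
  with * show "cauchy_equiv (\<lambda>n. c *\<^sub>R X n) (\<lambda>n. c *\<^sub>R X' n)"
    by (simp add: cauchy_equiv_def Cauchy_scaleR scaleR_diff_right)
qed

definition uminus_completion :: "'a completion \<Rightarrow> 'a completion" where
  "uminus_completion x = (-1) *\<^sub>R x"

definition minus_completion :: "'a completion \<Rightarrow> 'a completion \<Rightarrow> 'a completion" where
  "minus_completion x y = x + (-1) *\<^sub>R y"

lift_definition norm_completion :: "'a completion \<Rightarrow> real" is "\<lambda>X. lim (\<lambda>n. norm (X n))"
proof -
  fix X X' :: "nat \<Rightarrow> 'a"
  assume *: "cauchy_equiv X X'"
  have "(\<lambda>n. norm (X n) - norm (X' n)) \<longlonglongrightarrow> 0"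
  proof (rule Lim_null_comparison)
    show "\<forall>\<^sub>F n in sequentially. norm (norm (X n) - norm (X' n)) \<le> norm (X n - X' n)"
      by (simp add: norm_triangle_ineq3)
    show "(\<lambda>n. norm (X n - X' n)) \<longlonglongrightarrow> 0"
      using * by (simp add: cauchy_equiv_def tendsto_norm_zero)
  qed
  moreover have "(\<lambda>n. norm (X n) - norm (X' n)) \<longlonglongrightarrow> lim (\<lambda>n. norm (X n)) - lim (\<lambda>n. norm (X' n))"
    using * by (intro tendsto_diff Cauchy_convergent_norm) (simp_all add: cauchy_equiv_def)
  ultimately show "lim (\<lambda>n. norm (X n)) = lim (\<lambda>n. norm (X' n))"
    using LIMSEQ_unique by fastforce
qed

definition dist_completion :: "'a completion \<Rightarrow> 'a completion \<Rightarrow> real" where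
  "dist_completion x y = norm (x - y)"

definition sgn_completion :: "'a completion \<Rightarrow> 'a completion" where
  "sgn_completion x = inverse (norm x) *\<^sub>R x"

definition uniformity_completion :: "('a completion \<times> 'a completion) filter" where
  "uniformity_completion = (INF e\<in>{0<..}. principal {(x, y). dist x y < e})"

definition open_completion :: "'a completion set \<Rightarrow> bool" where
  "open_completion U \<longleftrightarrow> (\<forall>x\<in>U. eventually (\<lambda>(x', y). x' = x \<longrightarrow> y \<in> U) uniformity)"

instance
proof
  fix x y z :: "'a completion" and a b :: real
  show "x + y + z = x + (y + z)"
    by transfer (simp add: cauchy_equiv_def Cauchy_add add.assoc)
  show "x + y = y + x"
    by transfer (simp add: cauchy_equiv_def Cauchy_add add.commute)
  show "0 + x = x"
    by transfer (simp add: cauchy_equiv_def)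
  show "- x + x = 0" unfolding uminus_completion_def
    by transfer (simp add: cauchy_equiv_def convergent_Cauchy convergent_const)
  show "x - y = x + - y" by (simp add: minus_completion_def uminus_completion_def)
  show "a *\<^sub>R (x + y) = a *\<^sub>R x + a *\<^sub>R y"
    by transfer (simp add: cauchy_equiv_def Cauchy_add Cauchy_scaleR scaleR_add_right)
  show "(a + b) *\<^sub>R x = a *\<^sub>R x + b *\<^sub>R x"
    by transfer (simp add: cauchy_equiv_def Cauchy_add Cauchy_scaleR scaleR_add_left)
  show "a *\<^sub>R b *\<^sub>R x = (a * b) *\<^sub>R x"
    by transfer (simp add: cauchy_equiv_def Cauchy_scaleR)
  show "1 *\<^sub>R x = x"
    by transfer (simp add: cauchy_equiv_def)
  show "norm x = 0 \<longleftrightarrow> x = 0"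
  proof transfer
    fix X :: "nat \<Rightarrow> 'a" assume "cauchy_equiv X X"
    then have X: "Cauchy X" by (simp add: cauchy_equiv_def)
    note lim = Cauchy_convergent_norm[OF X]
    have "lim (\<lambda>n. norm (X n)) = 0 \<longleftrightarrow> (\<lambda>n. norm (X n)) \<longlonglongrightarrow> 0"
      using lim LIMSEQ_unique by metis
    also have "\<dots> \<longleftrightarrow> X \<longlonglongrightarrow> 0" by (rule tendsto_norm_zero_iff)
    finally show "lim (\<lambda>n. norm (X n)) = 0 \<longleftrightarrow> cauchy_equiv X (\<lambda>_. 0)"
      using X by (simp add: cauchy_equiv_def convergent_Cauchy convergent_const)
  qed
  show "norm (x + y) \<le> norm x + norm y"
  proof transfer
    fix X Y :: "nat \<Rightarrow> 'a" assume "cauchy_equiv X X" "cauchy_equiv Y Y"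
    then have XY: "Cauchy X" "Cauchy Y" by (simp_all add: cauchy_equiv_def)
    show "lim (\<lambda>n. norm (X n + Y n)) \<le> lim (\<lambda>n. norm (X n)) + lim (\<lambda>n. norm (Y n))"
      by (rule LIMSEQ_le[OF Cauchy_convergent_norm[OF Cauchy_add[OF XY]]
            tendsto_add[OF Cauchy_convergent_norm[OF XY(1)] Cauchy_convergent_norm[OF XY(2)]]])
        (simp add: norm_triangle_ineq)
  qed
  show "norm (a *\<^sub>R x) = \<bar>a\<bar> * norm x"
  proof transfer
    fix a and X :: "nat \<Rightarrow> 'a" assume "cauchy_equiv X X"
    then have "Cauchy X" by (simp add: cauchy_equiv_def)
    from tendsto_mult_left[OF Cauchy_convergent_norm[OF this], of "\<bar>a\<bar>"]
    show "lim (\<lambda>n. norm (a *\<^sub>R X n)) = \<bar>a\<bar> * lim (\<lambda>n. norm (X n))"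
      by (simp add: limI)
  qed
  show "dist x y = norm (x - y)" by (rule dist_completion_def)
  show "sgn x = inverse (norm x) *\<^sub>R x" by (rule sgn_completion_def)
  show "uniformity = (INF e\<in>{0<..}. principal {(x :: 'a completion, y). dist x y < e})"
    by (rule uniformity_completion_def)
  show "open U \<longleftrightarrow> (\<forall>x\<in>U. \<forall>\<^sub>F (x', y) in uniformity. x' = x \<longrightarrow> y \<in> U)"
    for U :: "'a completion set" by (rule open_completion_def)
qed

end

lift_definition completion_embed :: "'a::real_normed_vector \<Rightarrow> 'a completion" is "\<lambda>x _. x"
  by (simp add: cauchy_equiv_refl_iff convergent_Cauchy convergent_const)

lemma linear_completion_embed: "linear completion_embed"
proof (rule linearI)
  fix x y :: 'a and c :: real
  show "completion_embed (x + y) = completion_embed x + completion_embed y"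
    by transfer (simp add: cauchy_equiv_refl_iff convergent_Cauchy convergent_const)
  show "completion_embed (c *\<^sub>R x) = c *\<^sub>R completion_embed x"
    by transfer (simp add: cauchy_equiv_refl_iff convergent_Cauchy convergent_const)
qed

lemma norm_completion_embed: "norm (completion_embed x) = norm x"
  by transfer simp

lemma completion_embed_dist_small:
  fixes x :: "'a::real_normed_vector completion"
  assumes "0 < e"
  shows "\<exists>a. dist (completion_embed a) x < e"
  unfolding dist_norm minus_completion_def using assms
proof transfer
  fix e :: real and X :: "nat \<Rightarrow> 'a"
  assume e: "0 < e" and "cauchy_equiv X X"
  then have X: "Cauchy X" by (simp add: cauchy_equiv_def)
  obtain M where M: "\<forall>m\<ge>M. \<forall>n\<ge>M. dist (X m) (X n) < e / 2"
    using metric_CauchyD[OF X, of "e / 2"] e by auto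
  have C: "Cauchy (\<lambda>n. X M + (-1) *\<^sub>R X n)"
    by (intro Cauchy_add Cauchy_scaleR X) (simp add: convergent_Cauchy convergent_const)
  have "lim (\<lambda>n. norm (X M + (-1) *\<^sub>R X n)) \<le> e / 2"
    by (rule LIMSEQ_le_const2[OF Cauchy_convergent_norm[OF C]])
      (use M in \<open>auto simp: dist_norm intro!: exI[of _ M] less_imp_le\<close>)
  then show "\<exists>a. lim (\<lambda>n. norm (a + (-1) *\<^sub>R X n)) < e"
    using e by (intro exI[of _ "X M"]) simp
qed

lemma closure_range_completion_embed: "closure (range completion_embed) = UNIV"
  using completion_embed_dist_small by (auto simp: closure_approachable)

lemma completion_embed_LIMSEQ:
  fixes X :: "nat \<Rightarrow> 'a::real_normed_vector"
  assumes X: "Cauchy X"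
  shows "(\<lambda>m. completion_embed (X m)) \<longlonglongrightarrow> abs_completion X"
proof (rule metric_LIMSEQ_I)
  fix e :: real assume e: "0 < e"
  obtain M where M: "\<forall>m\<ge>M. \<forall>n\<ge>M. dist (X m) (X n) < e / 2"
    using metric_CauchyD[OF X, of "e / 2"] e by auto
  have XX: "cauchy_equiv X X" using X by (simp add: cauchy_equiv_def)
  have "dist (completion_embed (X m)) (abs_completion X) < e" if m: "m \<ge> M" for m
  proof -
    have C: "Cauchy (\<lambda>n. X m + (-1) *\<^sub>R X n)"
      by (intro Cauchy_add Cauchy_scaleR X) (simp add: convergent_Cauchy convergent_const)
    have c: "cauchy_equiv (\<lambda>_. X m) (\<lambda>_. X m)"
      by (simp add: cauchy_equiv_def convergent_Cauchy convergent_const)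
    have s: "cauchy_equiv (\<lambda>n. (-1) *\<^sub>R X n) (\<lambda>n. (-1) *\<^sub>R X n)"
      using Cauchy_scaleR[OF X, of "-1"] by (simp add: cauchy_equiv_def)
    have p: "cauchy_equiv (\<lambda>n. X m + (-1) *\<^sub>R X n) (\<lambda>n. X m + (-1) *\<^sub>R X n)"
      using C by (simp add: cauchy_equiv_def)
    have "dist (completion_embed (X m)) (abs_completion X)
        = lim (\<lambda>n. norm (X m + (-1) *\<^sub>R X n))"
      unfolding dist_norm minus_completion_def completion_embed.abs_eq
        scaleR_completion.abs_eq[OF XX] plus_completion.abs_eq[OF c s]
        norm_completion.abs_eq[OF p] ..
    also have "\<dots> \<le> e / 2"
      by (rule LIMSEQ_le_const2[OF Cauchy_convergent_norm[OF C]])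
        (use M m in \<open>auto simp: dist_norm intro!: exI[of _ M] less_imp_le\<close>)
    finally show ?thesis using e by simp
  qed
  then show "\<exists>M. \<forall>m\<ge>M. dist (completion_embed (X m)) (abs_completion X) < e" by blast
qed

instance completion :: (real_normed_vector) banach
proof
  fix x :: "nat \<Rightarrow> 'a completion" assume x: "Cauchy x"
  have "\<forall>n. \<exists>a. dist (completion_embed a) (x n) < inverse (real (Suc n))"
    using completion_embed_dist_small by (metis inverse_positive_iff_positive of_nat_0_less_iff zero_less_Suc)
  then obtain a where a: "\<And>n. dist (completion_embed (a n)) (x n) < inverse (real (Suc n))"
    by metis
  have close: "(\<lambda>n. dist (completion_embed (a n)) (x n)) \<longlonglongrightarrow> 0"
    by (rule tendsto_sandwich[OF _ _ tendsto_const LIMSEQ_inverse_real_of_nat])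
      (auto intro!: always_eventually less_imp_le[OF a] simp del: of_nat_Suc)
  have emb: "dist (completion_embed u) (completion_embed v) = dist u v" for u v :: 'a
    by (metis dist_norm linear_completion_embed linear_diff norm_completion_embed)
  have "Cauchy a"
  proof (rule metric_CauchyI)
    fix e :: real assume e: "0 < e"
    obtain M1 where M1: "\<forall>m\<ge>M1. \<forall>n\<ge>M1. dist (x m) (x n) < e / 3"
      using metric_CauchyD[OF x, of "e / 3"] e by auto
    obtain M2 where M2: "\<forall>n\<ge>M2. dist (completion_embed (a n)) (x n) < e / 3"
      using metric_LIMSEQ_D[OF close, of "e / 3"] e by auto
    have "dist (a m) (a n) < e" if "m \<ge> max M1 M2" "n \<ge> max M1 M2" for m n
    proof -
      have "dist (completion_embed (a m)) (x m) < e / 3"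
        "dist (completion_embed (a n)) (x n) < e / 3" "dist (x m) (x n) < e / 3"
        using M1 M2 that by auto
      then have "dist (completion_embed (a m)) (completion_embed (a n)) < e"
        using dist_triangle[of "completion_embed (a m)" "completion_embed (a n)" "x m"]
          dist_triangle2[of "x m" "completion_embed (a n)" "x n"] 
        by linarith
      then show ?thesis by (simp add: emb)
    qed
    then show "\<exists>M. \<forall>m\<ge>M. \<forall>n\<ge>M. dist (a m) (a n) < e" by blast
  qed
  then have lim: "(\<lambda>m. completion_embed (a m)) \<longlonglongrightarrow> abs_completion a"
    by (rule completion_embed_LIMSEQ)
  have "x \<longlonglongrightarrow> abs_completion a"
    by (rule Lim_transform[OF lim])
      (use close in \<open>simp add: dist_norm norm_minus_commute flip: tendsto_norm_zero_iff[of "\<lambda>n. x n - completion_embed (a n)"]\<close>)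
  then show "convergent x" by (auto simp: convergent_def)
qed

type_synonym tsirelson = "tsirelson_c00 completion"


section \<open>NIP and weak sequential completeness\<close>

definition IP_on :: "('a \<Rightarrow> 'a \<Rightarrow> real) \<Rightarrow> 'a set \<Rightarrow> bool" where
  "IP_on \<phi> M \<longleftrightarrow>
     (\<exists>(a :: nat \<Rightarrow> 'a) r s. range a \<subseteq> M \<and> r > s \<and>
        (\<forall>E F. finite E \<and> finite F \<and> E \<inter> F = {} \<longrightarrow>
           (\<exists>b\<in>M. (\<forall>n\<in>E. \<phi> (a n) b \<le> s) \<and> (\<forall>n\<in>F. \<phi> (a n) b \<ge> r))))"

definition NIP_on :: "('a \<Rightarrow> 'a \<Rightarrow> real) \<Rightarrow> 'a set \<Rightarrow> bool" where
  "NIP_on \<phi> M \<longleftrightarrow> \<not> IP_on \<phi> M"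

text \<open>For \<open>\<phi>\<close> with values in \<open>[0, 2]\<close>, the space of complete types over \<open>M\<close> in
  \<open>\<lambda>y x. \<phi> x y\<close>: the closure in \<open>[0, 2]\<^sup>M\<close> of the types \<open>x \<mapsto> \<phi> x b\<close>
  realised by \<open>b \<in> M\<close>.\<close>

definition cube_topology :: "'a set \<Rightarrow> ('a \<Rightarrow> real) topology" where
  "cube_topology M = product_topology (\<lambda>_. top_of_set {0..2}) M"

definition type_space :: "('a \<Rightarrow> 'a \<Rightarrow> real) \<Rightarrow> 'a set \<Rightarrow> ('a \<Rightarrow> real) topology" where
  "type_space \<phi> M =
     subtopology (cube_topology M)
       (cube_topology M closure_of ((\<lambda>b. \<lambda>x\<in>M. \<phi> x b) ` M))"

text \<open>The function \<open>\<phi>(a, y)\<close> on the type space is the evaluation \<open>q \<mapsto> q a\<close>.\<close>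

definition weakly_seq_complete_on :: "('a \<Rightarrow> 'a \<Rightarrow> real) \<Rightarrow> 'a set \<Rightarrow> bool" where
  "weakly_seq_complete_on \<phi> M \<longleftrightarrow>
     (\<forall>(a :: nat \<Rightarrow> 'a) g. range a \<subseteq> M \<and>
        (\<forall>q\<in>topspace (type_space \<phi> M). (\<lambda>n. q (a n)) \<longlonglongrightarrow> g q) \<longrightarrow>
        continuous_map (type_space \<phi> M) euclideanreal g)"

end

(* Any K successive blocks beyond coordinate K form an admissible family, so every vector of
   norm at most C has norm at most 2 C / K on one of them: on some block it is negligible.

   (i) If a sequence (a n) of finitely supported vectors were independent, every set S of naturals
   would be realised by a sequence (b S j) in a ball. Passing to a subsequence, b S j is, up to a
   small error, c + w with c fixed and w far to the right. For x to the left of w, a set of an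
   admissible family that meets x has at most max (supp x) companions; hence the norm of x + w
   depends on w, up to 2^-L, only through a monotone bounded function on L-tuples of naturals.
   Rounded to a finite grid, there are only countably many such functions, and only countably many
   c, so two different sets S share their parameters, which is absurd.

   (ii) Along the basis (e m), every type converges: on a block where the parameter b is
   negligible, the norm of e m + b increases with m because spreading to the right increases the
   norm. For the averages u n = (2/n) (e (n+1) + ... + e (2n)) the norm of e m + u n is at least
   3/2 for m > 2n but tends to 1 for fixed m as n grows, so the limit function is not continuous. *)

theory Submission
  imports Defs
begin

section \<open>Restrictions and admissible families\<close>

lift_definition proj :: "nat set \<Rightarrow> tsirelson_c00 \<Rightarrow> tsirelson_c00" is restr
  using finsupp_restr by (auto simp: restr_def)

lemma coord_proj: "coord (proj A x) k = (if k \<in> A then coord x k else 0)"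
  by transfer (simp add: restr_def)

lemma coord_add: "coord (x + y) k = coord x k + coord y k"
  by transfer simp

lemma coord_diff: "coord (x - y) k = coord x k - coord y k"
  unfolding minus_tsirelson_c00_def by transfer simp

lemma coord_scaleR: "coord (c *\<^sub>R x) k = c * coord x k"
  by transfer simp

lemma coord_zero: "coord 0 k = 0"
  by transfer simp

lemma coord_sum: "coord (sum f A) k = (\<Sum>i\<in>A. coord (f i) k)"
  by (induction A rule: infinite_finite_induct) (simp_all add: coord_zero coord_add)

lemmas coord_simps = coord_proj coord_add coord_diff coord_scaleR coord_zero coord_sum

lemma c00_eqI: "(\<And>k. coord x k = coord y k) \<Longrightarrow> x = y"
  by (metis coord_inject ext)

lemma finsupp_coord: "finsupp (coord x)"
  using coord by blast

lemma coord_proj_eq: "coord (proj A x) = restr A (coord x)"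
  by (rule proj.rep_eq)

lemma norm_coord: "norm x = tsirelson_norm (coord x)"
  by (rule norm_tsirelson_c00.rep_eq)

lemma proj_proj: "proj A (proj B x) = proj (A \<inter> B) x"
  by (rule c00_eqI) (simp add: coord_simps)

lemma proj_add: "proj A (x + y) = proj A x + proj A y"
  by (rule c00_eqI) (simp add: coord_simps)

lemma proj_eq_selfD: "proj A x = x \<Longrightarrow> k \<notin> A \<Longrightarrow> coord x k = 0"
  by (metis coord_proj)

lemma proj_eq_self_iff: "proj A x = x \<longleftrightarrow> (\<forall>k. k \<notin> A \<longrightarrow> coord x k = 0)"
  by (metis c00_eqI coord_proj)

lemma abs_coord_le_norm: "\<bar>coord x k\<bar> \<le> norm x"
  unfolding norm_coord by (rule abs_le_tsirelson_norm[OF finsupp_coord])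

lemma tnorm_le_norm: "tnorm n (coord x) \<le> norm x"
  unfolding norm_coord
  by (rule incseq_le[OF tnorm_mono tsirelson_norm_LIMSEQ[OF finsupp_coord]])

lemma norm_le_of_tnorm_le: "(\<And>n. tnorm n (coord x) \<le> c) \<Longrightarrow> norm x \<le> c"
  unfolding norm_coord
  by (rule LIMSEQ_le_const2[OF tsirelson_norm_LIMSEQ[OF finsupp_coord]]) blast

lemma norm_le_l1norm: "norm x \<le> l1norm (coord x)"
  using tnorm_bounds[OF finsupp_coord] by (blast intro: norm_le_of_tnorm_le)

lemma norm_le_sum_abs:
  assumes "finite A" "proj A x = x"
  shows "norm x \<le> (\<Sum>k\<in>A. \<bar>coord x k\<bar>)"
proof -
  have "l1norm (coord x) \<le> (\<Sum>k\<in>A. \<bar>coord x k\<bar>)"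
    unfolding l1norm_def using assms proj_eq_selfD[OF assms(2)] by (intro sum_mono2) auto
  then show ?thesis using norm_le_l1norm[of x] by linarith
qed

lemma tnorm_restr_le: "finsupp x \<Longrightarrow> tnorm n (restr A x) \<le> tnorm n x"
proof (induction n arbitrary: x)
  case 0
  have "\<bar>restr A x k\<bar> \<le> tnorm 0 x" for k
    using abs_le_tnorm[OF 0, of k] abs_le_tnorm[OF 0, of 0] by (auto simp: restr_def)
  then show ?case by (auto intro!: cSUP_least)
next
  case (Suc n)
  show ?case
  proof (rule tnorm_Suc_least)
    show "tnorm n (restr A x) \<le> tnorm (Suc n) x"
      using Suc.IH[OF Suc.prems] by simp
  next
    fix k :: nat and E assume k: "1 \<le> k" and E: "admissible k E"
    have comm: "restr (E i) (restr A x) = restr A (restr (E i) x)" for i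
      by (auto simp: restr_def)
    have "(1/2) * (\<Sum>i<k. tnorm n (restr (E i) (restr A x)))
        \<le> (1/2) * (\<Sum>i<k. tnorm n (restr (E i) x))"
      unfolding comm using Suc.IH Suc.prems
      by (intro mult_left_mono sum_mono) (auto simp: finsupp_restr)
    also have "\<dots> \<le> tnorm (Suc n) x"
      by (rule tnorm_family_le_Suc[OF Suc.prems k E])
    finally show "(1/2) * (\<Sum>i<k. tnorm n (restr (E i) (restr A x))) \<le> tnorm (Suc n) x" .
  qed
qed

lemma norm_proj_le: "norm (proj A x) \<le> norm x"
proof (rule norm_le_of_tnorm_le)
  show "tnorm n (coord (proj A x)) \<le> norm x" for n
    using tnorm_restr_le[OF finsupp_coord, of n A x] tnorm_le_norm[of n x]
    by (simp add: coord_proj_eq)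
qed

lemma norm_proj_mono: "A \<subseteq> B \<Longrightarrow> norm (proj A x) \<le> norm (proj B x)"
  by (metis proj_proj inf.absorb1 norm_proj_le)

section \<open>Families of successive sets and the implicit equation of the norm\<close>

lemma admissible_norm_sum_le:
  assumes k: "1 \<le> k" and E: "admissible k E"
  shows "(\<Sum>i<k. norm (proj (E i) x)) \<le> 2 * norm x"
proof (rule LIMSEQ_le_const2)
  show "(\<lambda>n. \<Sum>i<k. tnorm n (coord (proj (E i) x))) \<longlonglongrightarrow> (\<Sum>i<k. norm (proj (E i) x))"
    unfolding norm_coord by (intro tendsto_sum tsirelson_norm_LIMSEQ finsupp_coord)
  have "(\<Sum>i<k. tnorm n (coord (proj (E i) x))) \<le> 2 * norm x" for n
    using tnorm_family_le_Suc[OF finsupp_coord k E, of n x] tnorm_le_norm[of "Suc n" x]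
    by (simp add: coord_proj_eq del: tnorm.simps)
  then show "\<exists>N. \<forall>n\<ge>N. (\<Sum>i<k. tnorm n (coord (proj (E i) x))) \<le> 2 * norm x" by blast
qed

text \<open>Members of an admissible family are finite and nonempty. Cutting each \<open>A i\<close>
  down to the support and dropping those that miss it leaves at most \<open>k\<close> members, so
  the starting condition survives; infinite and empty sets may then be used freely.\<close>

lemma successive_norm_sum_le:
  assumes succ: "\<And>i j a b. i < j \<Longrightarrow> j < k \<Longrightarrow> a \<in> A i \<Longrightarrow> b \<in> A j \<Longrightarrow> a < b"
    and start: "\<And>i a. i < k \<Longrightarrow> a \<in> A i \<Longrightarrow> k \<le> a"
  shows "(\<Sum>i<k. norm (proj (A i) x)) \<le> 2 * norm x"
proof -
  define S where "S = {k. coord x k \<noteq> 0}"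
  have finS: "finite S" using finsupp_coord[of x] by (simp add: S_def finsupp_def)
  define I where "I = {i. i < k \<and> A i \<inter> S \<noteq> {}}"
  have finI: "finite I" and Ik: "card I \<le> k"
    using card_mono[of "{..<k}" I] by (auto simp: I_def)
  have projS: "proj (A i) x = proj (A i \<inter> S) x" for i
    by (rule c00_eqI) (auto simp: coord_simps S_def)
  have "(\<Sum>i<k. norm (proj (A i) x)) = (\<Sum>i\<in>I. norm (proj (A i \<inter> S) x))"
  proof (intro sum.mono_neutral_cong_right ballI)
    fix i assume "i \<in> {..<k} - I"
    then have "A i \<inter> S = {}" by (auto simp: I_def)
    then have "proj (A i) x = 0" unfolding projS by (intro c00_eqI) (simp add: coord_simps)
    then show "norm (proj (A i) x) = 0" by simp
  qed (auto simp: I_def projS)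
  also have "\<dots> \<le> 2 * norm x"
  proof (cases "I = {}")
    case False
    then have pos: "1 \<le> card I" using finI by (simp add: Suc_le_eq card_gt_0_iff)
    obtain h where h: "bij_betw h {..<card I} I" "strict_mono_on {..<card I} h"
      using ex_bij_betw_strict_mono_card[OF finI] by blast
    have hI: "h i < k" "A (h i) \<inter> S \<noteq> {}" if "i < card I" for i
      using bij_betw_apply[OF h(1), of i] that by (simp_all add: I_def)
    have Min_in: "Min (A (h i) \<inter> S) \<in> A (h i)" "Max (A (h i) \<inter> S) \<in> A (h i)"
      if "i < card I" for i
      using Min_in[OF _ hI(2)[OF that]] Max_in[OF _ hI(2)[OF that]] finS by blast+
    have adm: "admissible (card I) (\<lambda>i. A (h i) \<inter> S)"
      unfolding admissible_def
    proof (intro conjI allI impI)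
      show "card I \<le> Min (A (h 0) \<inter> S)"
        using start[OF hI(1) Min_in(1), of 0] pos Ik by simp
      show "Max (A (h i) \<inter> S) < Min (A (h (Suc i)) \<inter> S)" if "Suc i < card I" for i
        by (rule succ[of "h i" "h (Suc i)"])
          (use that h(2) hI Min_in in \<open>auto simp: strict_mono_on_def\<close>)
    qed (use hI finS in auto)
    have "(\<Sum>i\<in>I. norm (proj (A i \<inter> S) x)) = (\<Sum>i<card I. norm (proj (A (h i) \<inter> S) x))"
      using sum.reindex_bij_betw[OF h(1), of "\<lambda>i. norm (proj (A i \<inter> S) x)"] by simp
    then show ?thesis using admissible_norm_sum_le[OF pos adm, of x] by simp
  qed simp
  finally show ?thesis .
qed

lemma interval_norm_sum_le:
  assumes "mono t" "k \<le> t 0"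
  shows "(\<Sum>i<k. norm (proj {t i..<t (Suc i)} x)) \<le> 2 * norm x"
proof (rule successive_norm_sum_le)
  fix i j a b assume "i < j" "j < k" "a \<in> {t i..<t (Suc i)}" "b \<in> {t j..<t (Suc j)}"
  then show "a < b" using monoD[OF assms(1), of "Suc i" j] by auto
next
  fix i a assume "a \<in> {t i..<t (Suc i)}"
  then show "k \<le> a" using monoD[OF assms(1), of 0 i] assms(2) by auto
qed

lemma exists_small_block:
  assumes "mono T" "K \<le> T 0" "0 < K"
  obtains n where "n < K" "norm (proj {T n..<T (Suc n)} x) \<le> 2 * norm x / real K"
proof -
  have "\<exists>n<K. norm (proj {T n..<T (Suc n)} x) \<le> 2 * norm x / real K"
  proof (rule ccontr)
    assume "\<not> ?thesis"
    then have "(\<Sum>n<K. 2 * norm x / real K) < (\<Sum>n<K. norm (proj {T n..<T (Suc n)} x))"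
      using assms(3) by (intro sum_strict_mono) (auto simp: not_le)
    then show False using interval_norm_sum_le[OF assms(1,2), of x] assms(3) by simp
  qed
  then show thesis using that by blast
qed

text \<open>Letting each member fill the gap up to the next one keeps the first minimum and, as
  restrictions are contractive, loses nothing. Norms can thus be computed with intervals that share
  endpoints, given by one monotone sequence.\<close>

lemma admissible_intervals:
  assumes k: "1 \<le> k" and E: "admissible k E"
  obtains t where "mono t" "k \<le> t 0" "\<And>i. i < k \<Longrightarrow> E i \<subseteq> {t i..<t (Suc i)}"
proof
  \<comment> \<open>Constant from \<open>k\<close> on, which makes \<open>t\<close> monotone on all
    naturals.\<close>
  define t where "t i = (if i < k then Min (E i) else Suc (Max (E (k - 1))))" for i
  have fin: "finite (E i)" "E i \<noteq> {}" if "i < k" for i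
    using E that by (auto simp: admissible_def)
  have step: "Max (E i) < t (Suc i)" if "i < k" for i
  proof (cases "Suc i < k")
    case True
    then show ?thesis using E by (auto simp: admissible_def t_def)
  next
    case False
    then have "i = k - 1" using that by simp
    then show ?thesis using False by (simp add: t_def)
  qed
  show "mono t"
  proof (rule mono_iff_le_Suc[THEN iffD2, rule_format])
    fix i show "t i \<le> t (Suc i)"
    proof (cases "i < k")
      case True
      then have "Min (E i) \<le> Max (E i)" using fin by simp
      then show ?thesis using step[OF True] True by (simp add: t_def)
    qed (simp add: t_def)
  qed
  show "k \<le> t 0" using E k by (simp add: t_def admissible_def)
  show "E i \<subseteq> {t i..<t (Suc i)}" if "i < k" for i
  proof
    fix a assume a: "a \<in> E i"
    then have "Min (E i) \<le> a" "a \<le> Max (E i)" using fin[OF that] by auto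
    then show "a \<in> {t i..<t (Suc i)}" using step[OF that] that by (simp add: t_def)
  qed
qed

text \<open>Together with \<open>abs_coord_le_norm\<close> and \<open>interval_norm_sum_le\<close>
  this is the implicit equation of Figiel and Johnson, with the norm itself on both sides instead of
  its iterates.\<close>

lemma norm_least:
  assumes "\<And>k. \<bar>coord x k\<bar> \<le> c"
    and fam: "\<And>k t. mono t \<Longrightarrow> k \<le> t 0 \<Longrightarrow> (\<Sum>i<k. norm (proj {t i..<t (Suc i)} x)) \<le> 2 * c"
  shows "norm x \<le> c"
proof (rule norm_le_of_tnorm_le)
  show "tnorm n (coord x) \<le> c" for n
  proof (induction n)
    case 0
    then show ?case using assms(1) by (auto intro!: cSUP_least)
  next
    case (Suc n)
    show ?case
    proof (rule tnorm_Suc_least[OF Suc])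
      fix k :: nat and E assume k: "1 \<le> k" and E: "admissible k E"
      obtain t where t: "mono t" "k \<le> t 0" "\<And>i. i < k \<Longrightarrow> E i \<subseteq> {t i..<t (Suc i)}"
        using admissible_intervals[OF k E] by blast
      have "(\<Sum>i<k. tnorm n (restr (E i) (coord x))) \<le> (\<Sum>i<k. norm (proj {t i..<t (Suc i)} x))"
        using tnorm_le_norm[of n] norm_proj_mono[OF t(3)]
        by (intro sum_mono) (metis coord_proj_eq lessThan_iff order_trans)
      then show "(1/2) * (\<Sum>i<k. tnorm n (restr (E i) (coord x))) \<le> c"
        using fam[OF t(1,2)] by linarith
    qed
  qed
qed

lemma norm_greater_cases:
  assumes "c < norm x"
  obtains (coordinate) k where "c < \<bar>coord x k\<bar>"
  | (family) k t where "mono t" "k \<le> t 0" "2 * c < (\<Sum>i<k. norm (proj {t i..<t (Suc i)} x))"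
  using norm_least[of x c] assms by (meson not_le)

text \<open>Minimality of the norm: by induction every iterate \<open>tnorm n\<close> stays below
  \<open>F\<close>. The class \<open>P\<close>, closed under restriction, admits an \<open>F\<close>
  that behaves well only there.\<close>

lemma norm_le_functional:
  assumes "P x"
    and P: "\<And>x A. P x \<Longrightarrow> P (proj A x)"
    and coordinate: "\<And>x k. P x \<Longrightarrow> \<bar>coord x k\<bar> \<le> F x"
    and mono: "\<And>x A. P x \<Longrightarrow> F (proj A x) \<le> F x"
    and fam: "\<And>x k t. P x \<Longrightarrow> mono t \<Longrightarrow> k \<le> t 0 \<Longrightarrow>
      (\<Sum>i<k. F (proj {t i..<t (Suc i)} x)) \<le> 2 * F x"
  shows "norm x \<le> F x"
proof (rule norm_le_of_tnorm_le)
  show "tnorm n (coord x) \<le> F x" for n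
    using \<open>P x\<close>
  proof (induction n arbitrary: x)
    case 0
    then show ?case using coordinate by (auto intro!: cSUP_least)
  next
    case (Suc n)
    show ?case
    proof (rule tnorm_Suc_least[OF Suc.IH[OF Suc.prems]])
      fix k :: nat and E assume k: "1 \<le> k" and E: "admissible k E"
      obtain t where t: "mono t" "k \<le> t 0" "\<And>i. i < k \<Longrightarrow> E i \<subseteq> {t i..<t (Suc i)}"
        using admissible_intervals[OF k E] by blast
      have "tnorm n (restr (E i) (coord x)) \<le> F (proj {t i..<t (Suc i)} x)" if "i < k" for i
      proof -
        have "proj (E i) x = proj (E i) (proj {t i..<t (Suc i)} x)"
          using t(3)[OF that] by (simp add: proj_proj inf.absorb1)
        then show ?thesis
          using Suc.IH[OF P[OF Suc.prems], of "E i"] mono[OF P[OF Suc.prems], of "E i"]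
          by (metis coord_proj_eq order_trans)
      qed
      then have "(\<Sum>i<k. tnorm n (restr (E i) (coord x))) \<le> (\<Sum>i<k. F (proj {t i..<t (Suc i)} x))"
        by (intro sum_mono) simp
      then show "(1/2) * (\<Sum>i<k. tnorm n (restr (E i) (coord x))) \<le> F x"
        using fam[OF Suc.prems t(1,2)] by linarith
    qed
  qed
qed

section \<open>Profiles of blocks far to the right\<close>

text \<open>A set of an admissible family that meets the support of \<open>x\<close>, where \<open>x < w\<close>, forces the
  number of members to be at most \<open>max (supp x)\<close>. Hence \<open>w\<close> enters \<open>\<parallel>x + w\<parallel>\<close> only through
  the following values: the list records, from the outside inwards, how many further members
  are left for \<open>w\<close> at each nested set that meets both \<open>x\<close> and \<open>w\<close>.\<close>

primrec achieves :: "nat list \<Rightarrow> tsirelson_c00 \<Rightarrow> real \<Rightarrow> bool" where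
  "achieves [] w v \<longleftrightarrow> v = 0"
| "achieves (m # s) w v \<longleftrightarrow> (\<exists>t v'. mono t \<and> achieves s (proj {..<t 0} w) v' \<and>
     2 * v = v' + (\<Sum>i<m. norm (proj {t i..<t (Suc i)} w)))"

lemma sum_lessThan_split:
  fixes f :: "nat \<Rightarrow> 'a::comm_monoid_add"
  assumes "m \<le> n"
  shows "(\<Sum>i<n. f i) = (\<Sum>i<m. f i) + (\<Sum>i<n - m. f (m + i))"
proof -
  have "(\<Sum>i<m + d. f i) = (\<Sum>i<m. f i) + (\<Sum>i<d. f (m + i))" for d
    by (induction d) (simp_all add: add.assoc)
  then show ?thesis using assms by (metis le_add_diff_inverse)
qed

lemma sum_lessThan_split_at:
  fixes f :: "nat \<Rightarrow> 'a::comm_monoid_add"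
  assumes "m < n"
  shows "(\<Sum>i<n. f i) = (\<Sum>i<m. f i) + f m + (\<Sum>i<n - Suc m. f (Suc m + i))"
  using sum_lessThan_split[of "Suc m" n f] assms by simp

lemma proj_empty: "proj {} x = 0"
  by (rule c00_eqI) (simp add: coord_simps)

lemma proj_subset_eq: "proj A x = x \<Longrightarrow> proj A (proj B x) = proj B x"
  by (metis proj_proj inf_commute)

lemma achieves_zero: "achieves s w 0"
proof (induction s arbitrary: w)
  case (Cons m s)
  show ?case
    unfolding achieves.simps
    by (rule exI[of _ "\<lambda>_. 0"], rule exI[of _ 0]) (simp add: Cons proj_empty mono_def)
qed simp

lemma achieves_replicate_zero: "achieves (replicate n 0) w v \<Longrightarrow> v = 0"
  by (induction n arbitrary: w v) fastforce+

lemma achieves_mono: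
  assumes "list_all2 (\<le>) s s'" "achieves s w v"
  shows "achieves s' w v"
  using assms
proof (induction s s' arbitrary: w v rule: list_all2_induct)
  case (Cons m s m' s')
  from Cons.prems obtain t v' where t: "mono t" "achieves s (proj {..<t 0} w) v'"
    "2 * v = v' + (\<Sum>i<m. norm (proj {t i..<t (Suc i)} w))"
    by auto
  \<comment> \<open>The additional members allowed by the larger entry are made empty.\<close>
  define t' where "t' i = t (min i m)" for i
  have "mono t'" using t(1) by (auto simp: mono_def t'_def)
  moreover have "achieves s' (proj {..<t' 0} w) v'"
    using Cons.IH t(2) by (simp add: t'_def)
  moreover have "(\<Sum>i<m'. norm (proj {t' i..<t' (Suc i)} w)) = (\<Sum>i<m. norm (proj {t i..<t (Suc i)} w))"
    using Cons.hyps(1) by (intro sum.mono_neutral_cong_right) (auto simp: t'_def proj_empty)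
  ultimately show ?case using t(3) by (metis achieves.simps(2))
qed simp

text \<open>The entries are at most \<open>M\<close> and \<open>w\<close> starts at
  \<open>M\<close>, so every family involved is admissible for \<open>w\<close>. The factor 2
  survives the recursion: \<open>2 * v\<close> gets at most \<open>2 * norm w\<close> from the inner
  levels and as much from the family.\<close>

lemma achieves_le:
  assumes "achieves s w v" "proj {M..} w = w" "\<And>m. m \<in> set s \<Longrightarrow> m \<le> M"
  shows "v \<le> 2 * norm w"
  using assms
proof (induction s arbitrary: w v)
  case (Cons m s)
  from Cons.prems obtain t v' where t: "mono t" "achieves s (proj {..<t 0} w) v'"
    "2 * v = v' + (\<Sum>i<m. norm (proj {t i..<t (Suc i)} w))"
    by auto
  have "v' \<le> 2 * norm (proj {..<t 0} w)"
    using Cons.IH[OF t(2)] Cons.prems by (simp add: proj_subset_eq)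
  moreover have "norm (proj {..<t 0} w) \<le> norm w"
    by (rule norm_proj_le)
  moreover have "(\<Sum>i<m. norm (proj {t i..<t (Suc i)} w)) \<le> 2 * norm w"
  proof -
    have "(\<Sum>i<m. norm (proj ({t i..<t (Suc i)} \<inter> {M..}) w)) \<le> 2 * norm w"
    proof (rule successive_norm_sum_le)
      fix i j a b assume "i < j" "j < m" "a \<in> {t i..<t (Suc i)} \<inter> {M..}" "b \<in> {t j..<t (Suc j)} \<inter> {M..}"
      then show "a < b" using monoD[OF t(1), of "Suc i" j] by auto
    qed (use Cons.prems(3)[of m] in auto)
    moreover have "proj ({t i..<t (Suc i)} \<inter> {M..}) w = proj {t i..<t (Suc i)} w" for i
      by (metis Cons.prems(2) proj_proj)
    ultimately show ?thesis by simp
  qed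
  ultimately show ?case using t(3) by linarith
qed simp

text \<open>\<open>\<alpha>\<close> is what \<open>x\<close> contributes to a scheme of nested
  families, and \<open>s\<close> counts the places left at each level. The bound covers all
  \<open>w\<close> at once, so a scheme found for one \<open>w\<close> can be applied to
  another.\<close>

definition extends :: "nat \<Rightarrow> tsirelson_c00 \<Rightarrow> real \<Rightarrow> nat list \<Rightarrow> bool" where
  "extends N x \<alpha> s \<longleftrightarrow> (\<forall>w v. proj {N..} w = w \<longrightarrow> achieves s w v \<longrightarrow> \<alpha> + v \<le> norm (x + w))"

lemma norm_add_ge_left:
  assumes "proj {..<N} x = x" "proj {N..} w = w"
  shows "norm x \<le> norm (x + w)"
proof -
  have "proj {..<N} (x + w) = x"
    by (rule c00_eqI) (use assms in \<open>auto simp: coord_simps proj_eq_self_iff\<close>)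
  then show ?thesis by (metis norm_proj_le)
qed

text \<open>The case distinction follows the unique member of the norming family that meets both
  supports, if there is one; each step inwards halves the error.\<close>

lemma norm_add_decompose:
  assumes "proj {..<N} x = x" "proj {N..} w = w" "c < norm (x + w)"
  shows "c < norm w \<or> (\<exists>\<alpha> s v. length s = L \<and> (\<forall>m\<in>set s. m \<le> N) \<and> extends N x \<alpha> s \<and>
    achieves s w v \<and> c < \<alpha> + v + norm w / 2 ^ L)"
  using assms
proof (induction L arbitrary: x w c)
  case 0
  have "extends N x (norm x) []"
    using norm_add_ge_left[OF 0(1)] by (simp add: extends_def)
  moreover have "c < norm x + norm w"
    using 0(3) norm_triangle_ineq[of x w] by linarith
  ultimately show ?case by (intro disjI2 exI[of _ "norm x"] exI[of _ "[]"] exI[of _ 0]) simp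
next
  case (Suc L)
  note x = Suc.prems(1) and w = Suc.prems(2)
  have x0: "coord x k = 0" if "k \<ge> N" for k
    using proj_eq_selfD[OF x] that by simp
  have w0: "coord w k = 0" if "k < N" for k
    using proj_eq_selfD[OF w] that by simp
  \<comment> \<open>Here \<open>x\<close> alone suffices: no place is passed to \<open>w\<close>,
    and zeros pad the list to the required length.\<close>
  have only_x: ?case if "c < norm x"
  proof -
    have "extends N x (norm x) (replicate (Suc L) 0)"
      unfolding extends_def using norm_add_ge_left[OF x] achieves_replicate_zero by fastforce
    moreover have "c < norm x + 0 + norm w / 2 ^ Suc L"
    proof -
      have "0 \<le> norm w / 2 ^ Suc L" by simp
      then show ?thesis using that by linarith
    qed
    ultimately show ?thesis
      using achieves_zero[of "replicate (Suc L) 0" w]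
      by (rule_tac disjI2, rule_tac exI[of _ "norm x"], rule_tac exI[of _ "replicate (Suc L) 0"],
          rule_tac exI[of _ 0])
        (simp del: replicate_Suc achieves.simps)
  qed
  from Suc.prems(3) show ?case
  proof (cases rule: norm_greater_cases)
    case (coordinate k)
    show ?thesis
    proof (cases "k < N")
      case True
      then have "c < norm x"
        using coordinate w0[of k] abs_coord_le_norm[of x k] by (simp add: coord_simps)
      then show ?thesis by (rule only_x)
    next
      case False
      then have "c < norm w"
        using coordinate x0[of k] abs_coord_le_norm[of w k] by (simp add: coord_simps)
      then show ?thesis by blast
    qed
  next
    case (family k t)
    note t = monoD[OF family(1)]
    define y where "y i = proj {t i..<t (Suc i)} (x + w)" for i
    have sum: "2 * c < (\<Sum>i<k. norm (y i))" using family(3) by (simp add: y_def)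
    have y_w: "y i = proj {t i..<t (Suc i)} w" if "N \<le> t i" for i
      unfolding y_def by (rule c00_eqI) (use x0 that in \<open>auto simp: coord_simps\<close>)
    show ?thesis
    proof (cases "N \<le> t 0")
      case True
      then have "N \<le> t i" for i using t[of 0 i] by simp
      then have "(\<Sum>i<k. norm (y i)) = (\<Sum>i<k. norm (proj {t i..<t (Suc i)} w))"
        by (simp add: y_w)
      then show ?thesis using sum interval_norm_sum_le[OF family(1,2), of w] by simp
    next
      case False
      then have kN: "k \<le> N" using family(2) by simp
      \<comment> \<open>Members before \<open>i0\<close> end below \<open>N\<close> and see only
        \<open>x\<close>; those after it start at or beyond \<open>N\<close> and see only
        \<open>w\<close>. Only member \<open>i0\<close> can meet both supports.\<close>
      define i0 where "i0 = Max {i. i \<le> k \<and> t i < N}"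
      have fin: "finite {i. i \<le> k \<and> t i < N}" by simp
      have "i0 \<in> {i. i \<le> k \<and> t i < N}"
        unfolding i0_def using False by (intro Max_in[OF fin]) auto
      then have i0: "i0 \<le> k" "t i0 < N" by auto
      have i0_max: "i \<le> i0" if "i \<le> k" "t i < N" for i
        unfolding i0_def using that by (intro Max_ge[OF fin]) auto
      define A where "A = (\<Sum>i<i0. norm (proj {t i..<t (Suc i)} x))"
      have A_w2: "(\<Sum>i<i0. norm (proj (E i) (x + w2))) = A"
        if w2: "proj {N..} w2 = w2" and E: "\<And>i. i < i0 \<Longrightarrow> E i = {t i..<t (Suc i)}" for E w2
        unfolding A_def
      proof (rule sum.cong)
        fix i assume i: "i \<in> {..<i0}"
        then have "t (Suc i) < N" using t[of "Suc i" i0] i0(2) by simp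
        then have "proj (E i) (x + w2) = proj {t i..<t (Suc i)} x"
          by (intro c00_eqI) (use proj_eq_selfD[OF w2] i in \<open>auto simp: coord_simps E\<close>)
        then show "norm (proj (E i) (x + w2)) = norm (proj {t i..<t (Suc i)} x)" by simp
      qed simp
      have A: "(\<Sum>i<i0. norm (y i)) = A"
        unfolding y_def by (rule A_w2[OF w]) simp
      show ?thesis
      proof (cases "i0 = k")
        case True
        then have "2 * c < 2 * norm x"
          using sum A interval_norm_sum_le[OF family(1,2), of x] by (simp add: A_def)
        then show ?thesis by (intro only_x) simp
      next
        case False
        then have i0k: "i0 < k" using i0 by simp
        then have N_le: "N \<le> t (Suc i0)" using i0_max[of "Suc i0"] by (auto simp: not_less[symmetric])
        define r where "r = k - Suc i0"
        define B where "B = (\<Sum>i<r. norm (proj {t (Suc i0 + i)..<t (Suc (Suc i0 + i))} w))"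
        have B: "(\<Sum>i<r. norm (y (Suc i0 + i))) = B"
        proof -
          have "N \<le> t (Suc i0 + i)" for i using t[of "Suc i0" "Suc i0 + i"] N_le by simp
          then show ?thesis by (simp add: B_def y_w)
        qed
        have total: "2 * c < A + norm (y i0) + B"
          using sum sum_lessThan_split_at[OF i0k, of "\<lambda>i. norm (y i)"] A B by (simp add: r_def)
        define u where "u = proj {t i0..<N} x"
        define w' where "w' = proj {..<t (Suc i0)} w"
        have y0: "y i0 = u + w'"
          unfolding y_def u_def w'_def
          by (rule c00_eqI) (use x0 w0 i0 N_le in \<open>auto simp: coord_simps\<close>)
        have u: "proj {..<N} u = u" and w': "proj {N..} w' = w'"
          using x w unfolding u_def w'_def by (simp_all add: proj_subset_eq)
        have norm_w': "norm w' \<le> norm w" unfolding w'_def by (rule norm_proj_le)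
        \<comment> \<open>Doubling \<open>c\<close> and removing the other members leaves this bound
          for the mixed member; halving afterwards turns the error \<open>norm w' / 2 ^ L\<close>
          into the next power.\<close>
        have IH: "2 * c - A - B < norm w' \<or> (\<exists>\<alpha> s v. length s = L \<and> (\<forall>m\<in>set s. m \<le> N) \<and>
            extends N u \<alpha> s \<and> achieves s w' v \<and> 2 * c - A - B < \<alpha> + v + norm w' / 2 ^ L)"
          by (rule Suc.IH[OF u w']) (use total in \<open>simp add: y0\<close>)
        then show ?thesis
        proof (elim disjE exE conjE)
          assume c: "2 * c - A - B < norm w'"
          \<comment> \<open>In this case the mixed member may forget \<open>x\<close>: cut at
            \<open>N\<close>, it joins the members of \<open>w\<close>. That makes
            \<open>k - i0\<close> of them in one family and leaves nothing for deeper
            levels.\<close>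
          define s where "s = (k - i0) # replicate L 0"
          define t' where "t' i = (if i = 0 then N else t (i0 + i))" for i
          have t': "mono t'"
            unfolding mono_def t'_def using t N_le by (auto intro: order_trans[OF N_le])
          have "proj {N..<t (Suc i0)} w = w'"
            unfolding w'_def by (rule c00_eqI) (use w0 in \<open>auto simp: coord_simps\<close>)
          moreover have "k - i0 = Suc r" using i0k by (simp add: r_def)
          ultimately have sum_t': "(\<Sum>i<k - i0. norm (proj {t' i..<t' (Suc i)} w)) = norm w' + B"
            by (simp add: sum.lessThan_Suc_shift t'_def B_def del: sum.lessThan_Suc)
          have ach: "achieves s w ((norm w' + B) / 2)"
            unfolding s_def achieves.simps
            by (rule exI[of _ t'], rule exI[of _ 0]) (simp add: t' sum_t' achieves_zero)
          have "extends N x (A / 2) s"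
            unfolding extends_def
          proof (intro allI impI)
            fix w2 v assume w2: "proj {N..} w2 = w2" and "achieves s w2 v"
            then obtain \<tau> where \<tau>: "mono \<tau>"
              "2 * v = (\<Sum>i<k - i0. norm (proj {\<tau> i..<\<tau> (Suc i)} w2))"
              unfolding s_def using achieves_replicate_zero by fastforce
            \<comment> \<open>Intersecting with \<open>{N..}\<close> keeps the places given to
              \<open>w2\<close> beyond the members that hold \<open>x\<close>, and
              \<open>k \<le> N\<close> keeps the family admissible.\<close>
            define E where "E i = (if i < i0 then {t i..<t (Suc i)}
              else {\<tau> (i - i0)..<\<tau> (Suc (i - i0))} \<inter> {N..})" for i
            have "(\<Sum>i<k. norm (proj (E i) (x + w2))) \<le> 2 * norm (x + w2)"
            proof (rule successive_norm_sum_le)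
              fix i j a b assume ij: "i < j" "j < k" "a \<in> E i" "b \<in> E j"
              show "a < b"
              proof (cases "j < i0")
                case True
                then show ?thesis using ij t[of "Suc i" j] by (auto simp: E_def)
              next
                case j: False
                show ?thesis
                proof (cases "i < i0")
                  case True
                  then have "t (Suc i) < N" using t[of "Suc i" i0] i0(2) by simp
                  then show ?thesis using ij True j by (auto simp: E_def)
                next
                  case False
                  then have "\<tau> (Suc (i - i0)) \<le> \<tau> (j - i0)"
                    using ij by (intro monoD[OF \<tau>(1)]) linarith
                  then show ?thesis using ij False j by (auto simp: E_def)
                qed
              qed
            next
              fix i a assume "i < k" "a \<in> E i"
              then show "k \<le> a"
                using t[of 0 i] family(2) kN by (auto simp: E_def split: if_splits)
            qed
            moreover have "(\<Sum>i<k. norm (proj (E i) (x + w2))) = A + 2 * v"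
            proof -
              have "(\<Sum>i<k. norm (proj (E i) (x + w2))) = (\<Sum>i<i0. norm (proj (E i) (x + w2)))
                  + (\<Sum>i<k - i0. norm (proj (E (i0 + i)) (x + w2)))"
                using i0k by (intro sum_lessThan_split) simp
              also have "(\<Sum>i<i0. norm (proj (E i) (x + w2))) = A"
                by (rule A_w2[OF w2]) (simp add: E_def)
              also have "(\<Sum>i<k - i0. norm (proj (E (i0 + i)) (x + w2)))
                  = (\<Sum>i<k - i0. norm (proj {\<tau> i..<\<tau> (Suc i)} w2))"
                by (intro sum.cong refl arg_cong[of _ _ norm] c00_eqI)
                  (use x0 proj_eq_selfD[OF w2] in \<open>auto simp: coord_simps E_def\<close>)
              finally show ?thesis using \<tau>(2) by simp
            qed
            ultimately show "A / 2 + v \<le> norm (x + w2)" by simp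
          qed
          moreover have "c < A / 2 + (norm w' + B) / 2 + norm w / 2 ^ Suc L"
          proof -
            have "0 \<le> norm w / 2 ^ Suc L" by simp
            then show ?thesis using c by argo
          qed
          moreover have "length s = Suc L" "\<forall>m\<in>set s. m \<le> N"
            using kN by (auto simp: s_def)
          ultimately show ?thesis using ach by blast
        next
          fix \<alpha> s v assume s: "length s = L" "\<forall>m\<in>set s. m \<le> N" and ext: "extends N u \<alpha> s"
            and ach: "achieves s w' v" and c: "2 * c - A - B < \<alpha> + v + norm w' / 2 ^ L"
          have "achieves (r # s) w ((v + B) / 2)"
            unfolding achieves.simps
            by (rule exI[of _ "\<lambda>i. t (Suc i0 + i)"], rule exI[of _ v])
              (use ach t in \<open>auto simp: w'_def B_def mono_def\<close>)
          moreover have "extends N x ((A + \<alpha>) / 2) (r # s)"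
            unfolding extends_def
          proof (intro allI impI)
            fix w2 v2 assume w2: "proj {N..} w2 = w2" and "achieves (r # s) w2 v2"
            then obtain \<tau> v' where \<tau>: "mono \<tau>" "achieves s (proj {..<\<tau> 0} w2) v'"
              "2 * v2 = v' + (\<Sum>i<r. norm (proj {\<tau> i..<\<tau> (Suc i)} w2))"
              by auto
            have inner: "\<alpha> + v' \<le> norm (u + proj {..<\<tau> 0} w2)"
              using ext \<tau>(2) w2 by (auto simp: extends_def proj_subset_eq)
            \<comment> \<open>The mixed member runs up to the first endpoint of
              \<open>\<tau>\<close>, so it contains \<open>u\<close> and the part of
              \<open>w2\<close> handled by \<open>s\<close>; the maximum keeps all of
              \<open>u\<close> when \<open>\<tau> 0\<close> is below \<open>N\<close>.\<close>
            define E where "E i = (if i < i0 then {t i..<t (Suc i)}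
              else if i = i0 then {t i0..<max N (\<tau> 0)}
              else {\<tau> (i - Suc i0)..<\<tau> (Suc (i - Suc i0))} \<inter> {N..})" for i
            have "(\<Sum>i<k. norm (proj (E i) (x + w2))) \<le> 2 * norm (x + w2)"
            proof (rule successive_norm_sum_le)
              fix i j a b assume ij: "i < j" "j < k" "a \<in> E i" "b \<in> E j"
              consider "j \<le> i0" | "i < i0" "i0 < j" | "i = i0" "i0 < j" | "i0 < i" by linarith
              then show "a < b"
              proof cases
                case 1
                then show ?thesis using ij t[of "Suc i" j] by (auto simp: E_def split: if_splits)
              next
                case 2
                then have "t (Suc i) < N" using t[of "Suc i" i0] i0(2) by simp
                then show ?thesis using ij 2 by (auto simp: E_def)
              next
                case 3
                then show ?thesis
                  using ij monoD[OF \<tau>(1), of 0 "j - Suc i0"] by (auto simp: E_def)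
              next
                case 4
                then have "\<tau> (Suc (i - Suc i0)) \<le> \<tau> (j - Suc i0)"
                  using ij by (intro monoD[OF \<tau>(1)]) linarith
                then show ?thesis using ij 4 by (auto simp: E_def)
              qed
            next
              fix i a assume "i < k" "a \<in> E i"
              then show "k \<le> a"
                using t[of 0 i] family(2) kN by (auto simp: E_def split: if_splits)
            qed
            moreover have "(\<Sum>i<k. norm (proj (E i) (x + w2)))
                = A + norm (u + proj {..<\<tau> 0} w2) + (\<Sum>i<r. norm (proj {\<tau> i..<\<tau> (Suc i)} w2))"
            proof -
              have "(\<Sum>i<k. norm (proj (E i) (x + w2))) = (\<Sum>i<i0. norm (proj (E i) (x + w2)))
                  + norm (proj (E i0) (x + w2)) + (\<Sum>i<r. norm (proj (E (Suc i0 + i)) (x + w2)))"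
                unfolding r_def by (rule sum_lessThan_split_at[OF i0k])
              also have "(\<Sum>i<i0. norm (proj (E i) (x + w2))) = A"
                by (rule A_w2[OF w2]) (simp add: E_def)
              also have "proj (E i0) (x + w2) = u + proj {..<\<tau> 0} w2"
                by (rule c00_eqI)
                  (use x0 proj_eq_selfD[OF w2] i0 in \<open>auto simp: coord_simps E_def u_def\<close>)
              also have "(\<Sum>i<r. norm (proj (E (Suc i0 + i)) (x + w2)))
                  = (\<Sum>i<r. norm (proj {\<tau> i..<\<tau> (Suc i)} w2))"
                by (intro sum.cong refl arg_cong[of _ _ norm] c00_eqI)
                  (use x0 proj_eq_selfD[OF w2] in \<open>auto simp: coord_simps E_def\<close>)
              finally show ?thesis .
            qed
            ultimately have "A + \<alpha> + 2 * v2 \<le> 2 * norm (x + w2)"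
              using inner \<tau>(3) by argo
            then show "(A + \<alpha>) / 2 + v2 \<le> norm (x + w2)" by (simp add: field_simps)
          qed
          moreover have "c < (A + \<alpha>) / 2 + (v + B) / 2 + norm w / 2 ^ Suc L"
          proof -
            have "norm w' / 2 ^ L \<le> norm w / 2 ^ L"
              using norm_w' by (intro divide_right_mono) simp_all
            then show ?thesis using c by (simp add: field_simps)
          qed
          moreover have "length (r # s) = Suc L" "\<forall>m\<in>set (r # s). m \<le> N"
            using s kN by (auto simp: r_def)
          ultimately show ?thesis by blast
        qed
      qed
    qed
  qed
qed

section \<open>Stabilisation of monotone functions on tuples\<close>

lemma list_all2_map_min: "list_all2 (\<le>) (map (min J) s) (s :: nat list)"
  by (induction s) auto

lemma list_all2_map_min_mono: "J \<le> J' \<Longrightarrow> list_all2 (\<le>) (map (min J) s) (map (min J') (s :: nat list))"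
  by (induction s) auto

text \<open>Such a function is determined by \<open>J\<close> and its values on a finite grid, so there are only
  countably many of them.\<close>

lemma monotone_bounded_stabilises:
  fixes f :: "nat list \<Rightarrow> nat"
  assumes "\<And>s s'. length s = L \<Longrightarrow> list_all2 (\<le>) s s' \<Longrightarrow> f s \<le> f s'"
    and "\<And>s. length s = L \<Longrightarrow> f s \<le> B"
  shows "\<exists>J. \<forall>s. length s = L \<longrightarrow> f s = f (map (min J) s)"
  using assms
proof (induction L arbitrary: f)
  case (Suc L)
  note mono = Suc.prems(1) and bdd = Suc.prems(2)
  have "\<exists>J. \<forall>t. length t = L \<longrightarrow> f (k # t) = f (k # map (min J) t)" for k
  proof (rule Suc.IH)
    show "f (k # t) \<le> f (k # t')" if "length t = L" "list_all2 (\<le>) t t'" for t t'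
      using that by (intro mono) simp_all
    show "f (k # t) \<le> B" if "length t = L" for t
      using that by (intro bdd) simp
  qed
  then obtain Jk where Jk: "\<And>k t. length t = L \<Longrightarrow> f (k # t) = f (k # map (min (Jk k)) t)"
    by metis
  \<comment> \<open>The limit of \<open>f\<close> as the first entry grows is again monotone and
    bounded, on shorter lists, so the induction hypothesis applies to it too.\<close>
  define h where "h t = Max (range (\<lambda>k. f (k # t)))" for t
  have fin: "finite (range (\<lambda>k. f (k # t)))" if "length t = L" for t
    by (rule finite_subset[of _ "{..B}"]) (use that in \<open>auto intro!: bdd\<close>)
  have le_h: "f (k # t) \<le> h t" if "length t = L" for k t
    unfolding h_def using fin[OF that] by (intro Max_ge) auto
  have h_attained: "\<exists>k. h t = f (k # t)" if "length t = L" for t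
    using Max_in[OF fin[OF that]] by (auto simp: h_def)
  have h_mono: "h t \<le> h t'" if len: "length t = L" and le: "list_all2 (\<le>) t t'" for t t'
  proof -
    obtain k where "h t = f (k # t)" using h_attained[OF len] by blast
    also have "\<dots> \<le> f (k # t')" using len le by (intro mono) auto
    also have "\<dots> \<le> h t'" using len list_all2_lengthD[OF le] by (intro le_h) auto
    finally show ?thesis .
  qed
  have h_bdd: "h t \<le> B" if len: "length t = L" for t
  proof -
    obtain k where "h t = f (k # t)" using h_attained[OF len] by blast
    then show ?thesis using bdd[of "k # t"] len by simp
  qed
  have "\<exists>J. \<forall>t. length t = L \<longrightarrow> h t = h (map (min J) t)"
    by (rule Suc.IH[OF h_mono h_bdd])
  then obtain J0 where J0: "\<forall>t. length t = L \<longrightarrow> h t = h (map (min J0) t)" ..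
  obtain K where K: "\<And>t. length t = L \<Longrightarrow> h t = f (K t # t)"
    using h_attained by metis
  define G where "G = {t. set t \<subseteq> {..J0} \<and> length t = L}"
  have finG: "finite G" unfolding G_def by (rule finite_lists_length_eq) simp
  \<comment> \<open>Beyond \<open>k0\<close> the first entry no longer matters: the finitely many
    grid lists have all reached \<open>h\<close> by then, and monotonicity with the stability of
    \<open>h\<close> carries this to every list.\<close>
  define k0 where "k0 = (\<Sum>t\<in>G. K t)"
  have f_h: "f (k # t) = h t" if "k0 \<le> k" "length t = L" for k t
  proof (rule antisym[OF le_h[OF that(2)]])
    let ?t = "map (min J0) t"
    have "?t \<in> G" using that by (auto simp: G_def)
    then have "K ?t \<le> k" using member_le_sum[of ?t G K] finG that(1) by (simp add: k0_def)
    have "h t = h ?t" using J0 that(2) by blast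
    also have "\<dots> = f (K ?t # ?t)" by (rule K) (simp add: that(2))
    also have "\<dots> \<le> f (k # ?t)"
      using that \<open>K ?t \<le> k\<close> by (intro mono) (auto simp: list.rel_refl)
    also have "\<dots> \<le> f (k # t)"
      using that by (intro mono) (auto simp: list_all2_map_min)
    finally show "h t \<le> f (k # t)" .
  qed
  \<comment> \<open>The sum dominates \<open>k0\<close>, \<open>J0\<close> and the thresholds of the
    finitely many first entries below \<open>k0\<close>.\<close>
  define J where "J = k0 + J0 + (\<Sum>k<k0. Jk k)"
  have J: "f s = f (map (min J) s)" if len: "length s = Suc L" for s
  proof (rule antisym)
    obtain k t where s: "s = k # t" "length t = L" using len by (cases s) auto
    show "f s \<le> f (map (min J) s)"
    proof (cases "k < k0")
      case True
      then have "Jk k \<le> J" "min J k = k"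
        using member_le_sum[of k "{..<k0}" Jk] by (auto simp: J_def)
      have "f s = f (k # map (min (Jk k)) t)" unfolding s(1) by (rule Jk[OF s(2)])
      also have "\<dots> \<le> f (k # map (min J) t)"
        using s \<open>Jk k \<le> J\<close> by (intro mono) (auto simp: list_all2_map_min_mono)
      finally show ?thesis using s \<open>min J k = k\<close> by simp
    next
      case False
      have "f s = h t" using f_h[of k t] False s by simp
      also have "\<dots> = h (map (min J0) t)" using J0 s(2) by blast
      also have "\<dots> \<le> h (map (min J) t)"
        using s by (intro h_mono list_all2_map_min_mono) (auto simp: J_def)
      also have "\<dots> = f (map (min J) s)"
        using f_h[of "min J k" "map (min J) t"] False s by (simp add: J_def)
      finally show ?thesis .
    qed
    show "f (map (min J) s) \<le> f s"
      using that by (intro mono) (auto simp: list_all2_map_min)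
  qed
  then show ?case by (intro exI[of _ J] allI impI)
qed simp

text \<open>\<open>f s\<close> is a limit superior on the grid of mesh \<open>\<delta>\<close>: the
  highest multiple that infinitely many \<open>w M\<close> reach at \<open>s\<close>. It is bounded
  by \<open>achieves_le\<close>, once \<open>M\<close> dominates the entries of \<open>s\<close>,
  and monotone by \<open>achieves_mono\<close>, hence stable from some \<open>J\<close> on.\<close>

lemma exists_profile:
  assumes "infinite I" "0 < \<delta>"
    and w: "\<And>M. M \<in> I \<Longrightarrow> proj {M..} (w M) = w M" "\<And>M. M \<in> I \<Longrightarrow> norm (w M) \<le> C"
  obtains f J where
    "\<And>s. length s = L \<Longrightarrow> f s = f (map (min J) s)"
    "\<And>s. infinite {M \<in> I. \<exists>v\<ge>real (f s) * \<delta>. achieves s (w M) v}"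
    "\<And>s. finite {M \<in> I. \<exists>v\<ge>real (Suc (f s)) * \<delta>. achieves s (w M) v}"
proof -
  define X where "X s = {i. infinite {M \<in> I. \<exists>v\<ge>real i * \<delta>. achieves s (w M) v}}" for s
  have X_le: "i \<le> nat \<lceil>2 * C / \<delta>\<rceil>" if "i \<in> X s" for i s
  proof -
    have "\<exists>M>sum_list s. M \<in> {M \<in> I. \<exists>v\<ge>real i * \<delta>. achieves s (w M) v}"
      using that by (simp add: X_def infinite_nat_iff_unbounded)
    then obtain M v where M: "M > sum_list s" "M \<in> I" "real i * \<delta> \<le> v" "achieves s (w M) v"
      by blast
    have "v \<le> 2 * norm (w M)"
      by (rule achieves_le[OF M(4) w(1)[OF M(2)]])
        (use M(1) member_le_sum_list in \<open>fastforce intro: order_trans less_imp_le\<close>)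
    then have "real i * \<delta> \<le> 2 * C" using w(2)[OF M(2)] M(3) by linarith
    then have "real i \<le> 2 * C / \<delta>" using assms(2) by (simp add: field_simps)
    then show ?thesis by linarith
  qed
  have fin: "finite (X s)" for s
    using X_le by (intro finite_subset[of "X s" "{..nat \<lceil>2 * C / \<delta>\<rceil>}"]) auto
  have "0 \<in> X s" for s
  proof -
    have "{M \<in> I. \<exists>v\<ge>0. achieves s (w M) v} = I" using achieves_zero by blast
    then show ?thesis using assms(1) by (simp add: X_def)
  qed
  then have ne: "X s \<noteq> {}" for s by blast
  define f where "f s = Max (X s)" for s
  have f_in: "f s \<in> X s" for s unfolding f_def by (rule Max_in[OF fin ne])
  have "X s \<subseteq> X s'" if "list_all2 (\<le>) s s'" for s s'
  proof -
    have "{M \<in> I. \<exists>v\<ge>real i * \<delta>. achieves s (w M) v} \<subseteq> {M \<in> I. \<exists>v\<ge>real i * \<delta>. achieves s' (w M) v}" for i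
      using achieves_mono[OF that] by blast
    then show ?thesis unfolding X_def using infinite_super by blast
  qed
  then have mono: "f s \<le> f s'" if "list_all2 (\<le>) s s'" for s s'
    unfolding f_def using that fin ne by (intro Max_mono) auto
  have "f s \<le> nat \<lceil>2 * C / \<delta>\<rceil>" for s by (rule X_le[OF f_in])
  with mono have "\<exists>J. \<forall>s. length s = L \<longrightarrow> f s = f (map (min J) s)"
    by (intro monotone_bounded_stabilises) auto
  moreover have "Suc (f s) \<notin> X s" for s
    using Max_ge[OF fin, of "Suc (f s)" s] by (auto simp: f_def)
  ultimately show thesis
    using f_in that unfolding X_def by blast
qed

section \<open>Coding a sequence by countably many parameters\<close>

text \<open>If every \<open>N\<close> had a block \<open>{N..<m N}\<close> on which all late
  \<open>b j\<close> are large, then \<open>K\<close> such blocks in a row would be large for one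
  common \<open>j\<close>, against \<open>exists_small_block\<close>.\<close>

lemma exists_small_tails:
  fixes b :: "nat \<Rightarrow> tsirelson_c00"
  assumes "\<And>j. norm (b j) \<le> C" "0 < \<delta>"
  obtains N where "\<And>M J. \<exists>j\<ge>J. norm (proj {N..<M} (b j)) \<le> \<delta>"
proof -
  have "\<exists>N. \<forall>M J. \<exists>j\<ge>J. norm (proj {N..<M} (b j)) \<le> \<delta>"
  proof (rule ccontr)
    assume "\<not> ?thesis"
    then obtain m l where ml: "\<And>N j. j \<ge> l N \<Longrightarrow> norm (proj {N..<m N} (b j)) > \<delta>"
      by (metis not_le)
    have "N < m N" for N
      by (rule ccontr) (use ml[OF le_refl, of N] assms(2) in \<open>simp add: proj_empty\<close>)
    obtain K where K: "real K > 2 * C / \<delta>" using reals_Archimedean2 by blast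
    have "0 \<le> 2 * C / \<delta>"
      using order_trans[OF norm_ge_zero assms(1)[of 0]] assms(2) by simp
    then have "0 < K" using K by (metis less_le_trans of_nat_0_less_iff not_le)
    define T where "T = rec_nat K (\<lambda>_. m)"
    have T: "T 0 = K" "T (Suc n) = m (T n)" for n by (simp_all add: T_def)
    have "mono T" using \<open>\<And>N. N < m N\<close> by (simp add: mono_iff_le_Suc T less_imp_le)
    define j where "j = (\<Sum>n<K. l (T n))"
    obtain n where n: "n < K" "norm (proj {T n..<T (Suc n)} (b j)) \<le> 2 * norm (b j) / real K"
      using exists_small_block[OF \<open>mono T\<close> _ \<open>0 < K\<close>, of "b j"] T(1) by auto
    have "l (T n) \<le> j"
      using n(1) member_le_sum[of n "{..<K}" "\<lambda>n. l (T n)"] by (simp add: j_def)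
    then have "\<delta> < 2 * norm (b j) / real K" using ml[of "T n" j] n(2) T(2) by simp
    also have "\<dots> \<le> 2 * C / real K" using assms(1)[of j] by (intro divide_right_mono) auto
    also have "\<dots> < \<delta>" using K \<open>0 < K\<close> assms(2) by (simp add: field_simps)
    finally show False .
  qed
  then show thesis using that by blast
qed

text \<open>Two-sided on purpose: of two sequences with the same profile, one has almost all its
  values below the next level, while the other reaches the level itself infinitely often.\<close>

definition profile :: "real \<Rightarrow> nat \<Rightarrow> nat set \<Rightarrow> (nat \<Rightarrow> tsirelson_c00) \<Rightarrow> (nat list \<Rightarrow> nat) \<Rightarrow> bool" where
  "profile \<delta> L I w f \<longleftrightarrow> (\<forall>s. length s = L \<longrightarrow>
     infinite {M \<in> I. \<exists>v\<ge>real (f s) * \<delta>. achieves s (w M) v} \<and>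
     finite {M \<in> I. \<exists>v\<ge>real (Suc (f s)) * \<delta>. achieves s (w M) v})"

text \<open>The parameters of a code record, for a subsequence \<open>\<beta>\<close> of \<open>b\<close> without mass between \<open>N\<close>
  and \<open>M\<close>: the discretised coordinates below \<open>N\<close>, the discretised norm of the part \<open>w\<close> beyond
  \<open>M\<close>, and the profile of the latter.\<close>

definition codes :: "real \<Rightarrow> nat \<Rightarrow> (nat \<Rightarrow> tsirelson_c00) \<Rightarrow> nat set \<Rightarrow> (nat \<Rightarrow> tsirelson_c00) \<Rightarrow>
    (nat list \<Rightarrow> nat) \<Rightarrow> nat \<times> int list \<times> int \<times> nat \<times> nat list \<Rightarrow> bool" where
  "codes \<delta> L b I \<beta> f = (\<lambda>(N, xs, p, J, ls). infinite I \<and>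
     (\<forall>M\<in>I. (\<exists>j\<ge>M. \<beta> M = b j) \<and> norm (proj {N..<M} (\<beta> M)) \<le> \<delta> \<and>
        map (\<lambda>k. \<lfloor>coord (\<beta> M) k * real (Suc N) / \<delta>\<rfloor>) [0..<N] = xs \<and>
        \<lfloor>norm (proj {M..} (\<beta> M)) / \<delta>\<rfloor> = p) \<and>
     profile \<delta> L I (\<lambda>M. proj {M..} (\<beta> M)) f \<and>
     (\<forall>s. length s = L \<longrightarrow> f s = f (map (min J) s)) \<and>
     map f (List.n_lists L [0..<Suc J]) = ls)"

text \<open>Subsequence and profile function are quantified away, so that the code alone, an element
  of a countable type, remains for counting.\<close>

definition coded :: "real \<Rightarrow> nat \<Rightarrow> (nat \<Rightarrow> tsirelson_c00) \<Rightarrow>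
    nat \<times> int list \<times> int \<times> nat \<times> nat list \<Rightarrow> bool" where
  "coded \<delta> L b d \<longleftrightarrow> (\<exists>I \<beta> f. codes \<delta> L b I \<beta> f d)"

lemma floor_mem_if_abs_le:
  fixes y :: real
  assumes "\<bar>y\<bar> \<le> X"
  shows "\<lfloor>y\<rfloor> \<in> {- \<lceil>X\<rceil>..\<lceil>X\<rceil>}"
proof -
  have "- X \<le> y" "y \<le> X" using assms by linarith+
  then show ?thesis unfolding atLeastAtMost_iff by (intro conjI; linarith)
qed

text \<open>For each \<open>M\<close> a late term almost without mass in \<open>{N..<M}\<close> is
  chosen. Its rounded head and rounded tail norm take finitely many values, so they are constant on
  an infinite set of \<open>M\<close>; the profile is taken along that set.\<close>

lemma coded_exists:
  assumes b: "\<And>j. norm (b j) \<le> C" and \<delta>: "0 < \<delta>"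
  shows "\<exists>d. coded \<delta> L b d"
proof -
  obtain N where "\<And>M J. \<exists>j\<ge>J. norm (proj {N..<M} (b j)) \<le> \<delta>"
    using exists_small_tails[of b C \<delta>] b \<delta> by blast
  then have "\<forall>M. \<exists>j\<ge>M. norm (proj {N..<M} (b j)) \<le> \<delta>" by blast
  then obtain \<iota> where \<iota>: "\<And>M. \<iota> M \<ge> M" "\<And>M. norm (proj {N..<M} (b (\<iota> M))) \<le> \<delta>"
    by metis
  define \<beta> where "\<beta> M = b (\<iota> M)" for M
  define D where "D M = (map (\<lambda>k. \<lfloor>coord (\<beta> M) k * real (Suc N) / \<delta>\<rfloor>) [0..<N],
    \<lfloor>norm (proj {M..} (\<beta> M)) / \<delta>\<rfloor>)" for M
  define B where "B = \<lceil>C * real (Suc N) / \<delta>\<rceil>"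
  have floor_in: "\<lfloor>c * real (Suc N) / \<delta>\<rfloor> \<in> {-B..B}" if "\<bar>c\<bar> \<le> C" for c
    unfolding B_def
  proof (rule floor_mem_if_abs_le)
    show "\<bar>c * real (Suc N) / \<delta>\<bar> \<le> C * real (Suc N) / \<delta>"
      using that \<delta> by (simp add: abs_mult divide_right_mono mult_right_mono del: of_nat_Suc)
  qed
  have floor_in': "\<lfloor>c / \<delta>\<rfloor> \<in> {-B..B}" if "0 \<le> c" "c \<le> C" for c
    unfolding B_def
  proof (rule floor_mem_if_abs_le)
    have "c * 1 \<le> C * real (Suc N)"
      using that by (intro mult_mono) auto
    then show "\<bar>c / \<delta>\<bar> \<le> C * real (Suc N) / \<delta>"
      using that \<delta> by (simp add: divide_right_mono del: of_nat_Suc)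
  qed
  have "range D \<subseteq> {xs. set xs \<subseteq> {-B..B} \<and> length xs = N} \<times> {-B..B}"
  proof -
    have "\<lfloor>coord (b j) k * real (Suc N) / \<delta>\<rfloor> \<in> {-B..B}" for j k
      by (rule floor_in[OF order_trans[OF abs_coord_le_norm b]])
    moreover have "\<lfloor>norm (proj A (b j)) / \<delta>\<rfloor> \<in> {-B..B}" for j A
      by (rule floor_in'[OF norm_ge_zero order_trans[OF norm_proj_le b]])
    ultimately show ?thesis
      unfolding D_def \<beta>_def by (auto simp del: of_nat_Suc atLeastAtMost_iff)
  qed
  moreover have "finite ({xs. set xs \<subseteq> {-B..B} \<and> length xs = N} \<times> {-B..B})"
    by (intro finite_cartesian_product finite_lists_length_eq) auto
  ultimately have "finite (range D)" by (rule finite_subset)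
  then obtain M0 where "infinite {M. D M = D M0}"
    using pigeonhole_infinite[of "UNIV :: nat set" D] by auto
  define I where "I = {M. D M = D M0}"
  have I: "infinite I" using \<open>infinite {M. D M = D M0}\<close> by (simp add: I_def)
  obtain f J where f: "\<And>s. length s = L \<Longrightarrow> f s = f (map (min J) s)"
    "\<And>s. infinite {M \<in> I. \<exists>v\<ge>real (f s) * \<delta>. achieves s (proj {M..} (\<beta> M)) v}"
    "\<And>s. finite {M \<in> I. \<exists>v\<ge>real (Suc (f s)) * \<delta>. achieves s (proj {M..} (\<beta> M)) v}"
  proof (rule exists_profile[OF I \<delta>, of "\<lambda>M. proj {M..} (\<beta> M)" C L])
    show "norm (proj {M..} (\<beta> M)) \<le> C" for M
      unfolding \<beta>_def by (rule order_trans[OF norm_proj_le b])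
    show "proj {M..} (proj {M..} (\<beta> M)) = proj {M..} (\<beta> M)" for M
      by (simp add: proj_proj)
  qed (rule that)
  have prof: "profile \<delta> L I (\<lambda>M. proj {M..} (\<beta> M)) f" using f(2,3) by (simp add: profile_def)
  have blocks: "\<forall>M\<in>I. (\<exists>j\<ge>M. \<beta> M = b j) \<and> norm (proj {N..<M} (\<beta> M)) \<le> \<delta> \<and>
        map (\<lambda>k. \<lfloor>coord (\<beta> M) k * real (Suc N) / \<delta>\<rfloor>) [0..<N] = fst (D M0) \<and>
        \<lfloor>norm (proj {M..} (\<beta> M)) / \<delta>\<rfloor> = snd (D M0)"
    using \<iota> by (auto simp: I_def D_def \<beta>_def)
  have "codes \<delta> L b I \<beta> f (N, fst (D M0), snd (D M0), J, map f (List.n_lists L [0..<Suc J]))"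
    unfolding codes_def prod.case by (intro conjI I blocks prof refl allI impI f(1))
  then show ?thesis unfolding coded_def by blast
qed

section \<open>Comparison of sequences with the same code\<close>

lemma norm_add_ge_right:
  assumes "proj {..<N} x = x" "proj {N..} w = w"
  shows "norm w \<le> norm (x + w)"
proof -
  have "proj {N..} (x + w) = w"
    by (rule c00_eqI) (use assms in \<open>auto simp: coord_simps proj_eq_self_iff\<close>)
  then show ?thesis by (metis norm_proj_le)
qed

lemma exists_support_bound: "\<exists>N. proj {..<N} x = x"
proof -
  have "finite {k. coord x k \<noteq> 0}" using finsupp_coord by (simp add: finsupp_def)
  then obtain N where "\<forall>k\<in>{k. coord x k \<noteq> 0}. k < N" using finite_nat_set_iff_bounded by blast
  then show ?thesis by (auto simp: proj_eq_self_iff)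
qed

lemma proj_lessThan_mono: "proj {..<N} x = x \<Longrightarrow> N \<le> M \<Longrightarrow> proj {..<M} x = x"
  by (auto simp: proj_eq_self_iff)

lemma abs_diff_less_if_floor_eq:
  fixes a b c :: real
  assumes "\<lfloor>a / c\<rfloor> = \<lfloor>b / c\<rfloor>" "0 < c"
  shows "\<bar>a - b\<bar> < c"
proof -
  have "\<bar>a / c - b / c\<bar> < 1" using assms(1) by linarith
  then show ?thesis using assms(2) by (simp add: abs_divide flip: diff_divide_distrib)
qed

text \<open>Error budget: on each side \<open>2 * \<delta>\<close> for head and gap when passing to
  \<open>z\<close> plus a tail, \<open>\<delta>\<close> for a strict inequality,
  \<open>\<delta>\<close> for the grid of the profile or of the tail norms, and
  \<open>C / 2 ^ L\<close> for the depth.\<close>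

lemma same_code_close:
  assumes d: "coded \<delta> L b d" "coded \<delta> L b' d" and \<delta>: "0 < \<delta>"
    and C: "\<And>j. norm (b j) \<le> C"
    and r: "\<And>j. n \<le> j \<Longrightarrow> r \<le> norm (x + b j)"
    and s: "\<And>j. n \<le> j \<Longrightarrow> norm (x + b' j) \<le> s"
  shows "r \<le> s + 6 * \<delta> + C / 2 ^ L"
proof -
  obtain N xs p J ls where d_eq: "d = (N, xs, p, J, ls)" by (cases d)
  obtain I \<beta> f where "codes \<delta> L b I \<beta> f d"
    using d(1) unfolding coded_def by blast
  then have I: "infinite I"
    and \<beta>: "\<And>M. M \<in> I \<Longrightarrow> \<exists>j\<ge>M. \<beta> M = b j"
      "\<And>M. M \<in> I \<Longrightarrow> norm (proj {N..<M} (\<beta> M)) \<le> \<delta>"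
      "\<And>M. M \<in> I \<Longrightarrow> map (\<lambda>k. \<lfloor>coord (\<beta> M) k * real (Suc N) / \<delta>\<rfloor>) [0..<N] = xs"
      "\<And>M. M \<in> I \<Longrightarrow> \<lfloor>norm (proj {M..} (\<beta> M)) / \<delta>\<rfloor> = p"
    and f: "profile \<delta> L I (\<lambda>M. proj {M..} (\<beta> M)) f"
      "\<And>s. length s = L \<Longrightarrow> f s = f (map (min J) s)"
      "map f (List.n_lists L [0..<Suc J]) = ls"
    unfolding d_eq codes_def prod.case by blast+
  obtain I' \<beta>' f' where "codes \<delta> L b' I' \<beta>' f' d"
    using d(2) unfolding coded_def by blast
  then have I': "infinite I'"
    and \<beta>': "\<And>M. M \<in> I' \<Longrightarrow> \<exists>j\<ge>M. \<beta>' M = b' j"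
      "\<And>M. M \<in> I' \<Longrightarrow> norm (proj {N..<M} (\<beta>' M)) \<le> \<delta>"
      "\<And>M. M \<in> I' \<Longrightarrow> map (\<lambda>k. \<lfloor>coord (\<beta>' M) k * real (Suc N) / \<delta>\<rfloor>) [0..<N] = xs"
      "\<And>M. M \<in> I' \<Longrightarrow> \<lfloor>norm (proj {M..} (\<beta>' M)) / \<delta>\<rfloor> = p"
    and f': "profile \<delta> L I' (\<lambda>M. proj {M..} (\<beta>' M)) f'"
      "\<And>s. length s = L \<Longrightarrow> f' s = f' (map (min J) s)"
      "map f' (List.n_lists L [0..<Suc J]) = ls"
    unfolding d_eq codes_def prod.case by blast+
  have ff': "f s = f' s" if "length s = L" for s
  proof -
    have "map (min J) s \<in> set (List.n_lists L [0..<Suc J])"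
      using that by (auto simp: set_n_lists)
    moreover have "map f (List.n_lists L [0..<Suc J]) = map f' (List.n_lists L [0..<Suc J])"
      by (simp only: f(3) f'(3))
    ultimately have "f (map (min J) s) = f' (map (min J) s)"
      unfolding map_eq_conv by blast
    then show ?thesis by (simp only: f(2)[OF that] f'(2)[OF that])
  qed
  obtain M0 where M0: "M0 \<in> I" using I by (metis ex_in_conv finite.emptyI)
  \<comment> \<open>The head of a single term serves both sequences, since all rounded heads
    agree.\<close>
  define z where "z = x + proj {..<N} (\<beta> M0)"
  \<comment> \<open>The mesh \<open>\<delta> / real (Suc N)\<close> keeps the total over
    \<open>N\<close> coordinates within \<open>\<delta>\<close>.\<close>
  have head: "norm (proj {..<N} y - proj {..<N} (\<beta> M0)) \<le> \<delta>"
    if y: "map (\<lambda>k. \<lfloor>coord y k * real (Suc N) / \<delta>\<rfloor>) [0..<N] = xs" for y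
  proof -
    let ?y = "proj {..<N} y - proj {..<N} (\<beta> M0)"
    have "\<bar>coord ?y k\<bar> \<le> \<delta> / real (Suc N)" if "k < N" for k
    proof -
      have "\<forall>k\<in>set [0..<N]. \<lfloor>coord y k * real (Suc N) / \<delta>\<rfloor> = \<lfloor>coord (\<beta> M0) k * real (Suc N) / \<delta>\<rfloor>"
        unfolding map_eq_conv[symmetric] by (simp only: y \<beta>(3)[OF M0])
      then have "\<lfloor>coord y k * real (Suc N) / \<delta>\<rfloor> = \<lfloor>coord (\<beta> M0) k * real (Suc N) / \<delta>\<rfloor>"
        using that by simp
      then have "\<bar>coord y k - coord (\<beta> M0) k\<bar> < \<delta> / real (Suc N)"
        using \<delta> by (intro abs_diff_less_if_floor_eq) (simp_all del: of_nat_Suc)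
      then show ?thesis using that by (simp add: coord_simps del: of_nat_Suc)
    qed
    then have "(\<Sum>k<N. \<bar>coord ?y k\<bar>) \<le> real N * (\<delta> / real (Suc N))"
      using sum_mono[of "{..<N}" "\<lambda>k. \<bar>coord ?y k\<bar>" "\<lambda>_. \<delta> / real (Suc N)"] by simp
    moreover have "norm ?y \<le> (\<Sum>k<N. \<bar>coord ?y k\<bar>)"
      by (rule norm_le_sum_abs) (auto simp: proj_eq_self_iff coord_simps)
    moreover have "real N * (\<delta> / real (Suc N)) \<le> \<delta>" using \<delta> by (simp add: field_simps)
    ultimately show ?thesis by linarith
  qed
  have close: "norm ((x + y) - (z + proj {M..} y)) \<le> 2 * \<delta>"
    if "map (\<lambda>k. \<lfloor>coord y k * real (Suc N) / \<delta>\<rfloor>) [0..<N] = xs"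
      "norm (proj {N..<M} y) \<le> \<delta>" "N \<le> M" for y M
  proof -
    have "(x + y) - (z + proj {M..} y) = (proj {..<N} y - proj {..<N} (\<beta> M0)) + proj {N..<M} y"
      by (rule c00_eqI) (use that(3) in \<open>auto simp: z_def coord_simps\<close>)
    then show ?thesis
      using norm_triangle_ineq[of "proj {..<N} y - proj {..<N} (\<beta> M0)" "proj {N..<M} y"]
        head[OF that(1)] that(2) by simp
  qed
  obtain N0 where "proj {..<N0} z = z" using exists_support_bound by blast
  \<comment> \<open>Beyond the support of \<open>z\<close>, beyond the head, and late enough for the
    bounds by \<open>r\<close> and \<open>s\<close>.\<close>
  define N1 where "N1 = N0 + N + n"
  have z: "proj {..<N1} z = z"
    by (rule proj_lessThan_mono[OF \<open>proj {..<N0} z = z\<close>]) (simp add: N1_def)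
  define G where "G = {s. set s \<subseteq> {..N1} \<and> length s = L}"
  \<comment> \<open>The list supplied by the decomposition depends on \<open>M\<close>, so
    \<open>M\<close> has to be good for all candidates at once; with entries up to \<open>N1\<close>
    these are finitely many.\<close>
  define X where "X = (\<Union>s\<in>G. {M \<in> I. \<exists>v\<ge>real (Suc (f s)) * \<delta>. achieves s (proj {M..} (\<beta> M)) v})"
  have "finite G" unfolding G_def by (rule finite_lists_length_eq) simp
  then have "finite X"
    unfolding X_def using f(1) by (intro finite_UN_I) (simp_all add: G_def profile_def)
  then have "infinite (I - X)" using I by (rule Diff_infinite_finite)
  then obtain M where M: "M \<in> I" "N1 < M" and "M \<notin> X"
    unfolding infinite_nat_iff_unbounded by blast
  have small: "v < real (Suc (f s)) * \<delta>" if "s \<in> G" "achieves s (proj {M..} (\<beta> M)) v" for s v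
    using \<open>M \<notin> X\<close> M(1) that unfolding X_def by (auto simp: not_le[symmetric])
  define w where "w = proj {M..} (\<beta> M)"
  have w: "proj {N1..} w = w" unfolding w_def using M(2) by (auto simp: proj_eq_self_iff coord_simps)
  have "norm (\<beta> M) \<le> C" using \<beta>(1)[OF M(1)] C by auto
  then have norm_w: "norm w \<le> C"
    unfolding w_def by (rule order_trans[OF norm_proj_le])
  have "r \<le> norm (x + \<beta> M)"
    using \<beta>(1)[OF M(1)] M(2) r by (auto simp: N1_def)
  moreover have "norm ((x + \<beta> M) - (z + w)) \<le> 2 * \<delta>"
    unfolding w_def
    by (rule close[OF \<beta>(3)[OF M(1)] \<beta>(2)[OF M(1)]]) (use M(2) in \<open>simp add: N1_def\<close>)
  ultimately have "r - 3 * \<delta> < norm (z + w)"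
    using norm_triangle_ineq2[of "x + \<beta> M" "z + w"] \<delta> by linarith
  note decomposition = norm_add_decompose[OF z w this, of L]
  have upper: "norm (z + proj {M'..} (\<beta>' M')) \<le> s + 2 * \<delta>" "proj {N1..} (proj {M'..} (\<beta>' M')) = proj {M'..} (\<beta>' M')"
    if "M' \<in> I'" "N1 < M'" for M'
  proof -
    have "norm (x + \<beta>' M') \<le> s"
      using \<beta>'(1)[OF that(1)] that(2) s by (auto simp: N1_def)
    moreover have "norm ((x + \<beta>' M') - (z + proj {M'..} (\<beta>' M'))) \<le> 2 * \<delta>"
      by (rule close[OF \<beta>'(3)[OF that(1)] \<beta>'(2)[OF that(1)]])
        (use that(2) in \<open>simp add: N1_def\<close>)
    ultimately show "norm (z + proj {M'..} (\<beta>' M')) \<le> s + 2 * \<delta>"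
      using norm_triangle_ineq3[of "x + \<beta>' M'" "z + proj {M'..} (\<beta>' M')"] by linarith
    show "proj {N1..} (proj {M'..} (\<beta>' M')) = proj {M'..} (\<beta>' M')"
      using that(2) by (auto simp: proj_eq_self_iff coord_simps)
  qed
  have "0 \<le> C / 2 ^ L" using order_trans[OF norm_ge_zero norm_w] by simp
  from decomposition show ?thesis
  proof (elim disjE exE conjE)
    assume "r - 3 * \<delta> < norm w"
    obtain M' where M': "M' \<in> I'" "N1 < M'" using I' by (auto simp: infinite_nat_iff_unbounded)
    have "\<bar>norm w - norm (proj {M'..} (\<beta>' M'))\<bar> < \<delta>"
      using \<beta>(4)[OF M(1)] \<beta>'(4)[OF M'(1)] \<delta>
      by (intro abs_diff_less_if_floor_eq) (simp_all add: w_def)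
    moreover have "norm (proj {M'..} (\<beta>' M')) \<le> s + 2 * \<delta>"
      using norm_add_ge_right[OF z upper(2)[OF M']] upper(1)[OF M'] by linarith
    ultimately show ?thesis using \<open>r - 3 * \<delta> < norm w\<close> \<open>0 \<le> C / 2 ^ L\<close> by linarith
  next
    fix \<alpha> u v assume u: "length u = L" "\<forall>m\<in>set u. m \<le> N1" and ext: "extends N1 z \<alpha> u"
      and v: "achieves u w v" "r - 3 * \<delta> < \<alpha> + v + norm w / 2 ^ L"
    have "v < real (Suc (f' u)) * \<delta>"
      using small[of u v] v(1) u ff'[OF u(1)] by (auto simp: G_def w_def)
    moreover have "infinite {M \<in> I'. \<exists>v\<ge>real (f' u) * \<delta>. achieves u (proj {M..} (\<beta>' M)) v}"
      using f'(1) u(1) by (simp add: profile_def)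
    \<comment> \<open>The term of the other sequence is chosen after \<open>u\<close>, so it is
      enough that infinitely many terms reach the level.\<close>
    then obtain M' v' where M': "M' \<in> I'" "N1 < M'"
      and v': "real (f' u) * \<delta> \<le> v'" "achieves u (proj {M'..} (\<beta>' M')) v'"
      unfolding infinite_nat_iff_unbounded by blast
    moreover have "\<alpha> + v' \<le> s + 2 * \<delta>"
      using ext[unfolded extends_def, rule_format, OF upper(2)[OF M'] v'(2)] upper(1)[OF M']
      by linarith
    moreover have "norm w / 2 ^ L \<le> C / 2 ^ L" using norm_w by (intro divide_right_mono) auto
    ultimately show ?thesis using v(2) by (simp add: algebra_simps)
  qed
qed

lemma not_independent_c00:
  fixes a :: "nat \<Rightarrow> tsirelson_c00"
  assumes "s < r"
  shows "\<exists>E F. finite E \<and> finite F \<and> E \<inter> F = {} \<and>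
    (\<forall>b. norm b \<le> C \<longrightarrow> (\<exists>n\<in>E. s < norm (a n + b)) \<or> (\<exists>n\<in>F. norm (a n + b) < r))"
proof (rule ccontr)
  assume "\<not> ?thesis"
  then have ip: "\<exists>b. norm b \<le> C \<and> (\<forall>n\<in>E. norm (a n + b) \<le> s) \<and> (\<forall>n\<in>F. r \<le> norm (a n + b))"
    if "finite E" "finite F" "E \<inter> F = {}" for E F
    using that by (meson not_le)
  \<comment> \<open>Independence realises finite patterns only, so \<open>b S j\<close> is right
    about the indices up to \<open>j\<close>. Each index is settled from some \<open>j\<close> on,
    as \<open>same_code_close\<close> requires.\<close>
  have "\<forall>S j. \<exists>b. norm b \<le> C \<and> (\<forall>n\<in>{..j} - S. norm (a n + b) \<le> s) \<and>
      (\<forall>n\<in>{..j} \<inter> S. r \<le> norm (a n + b))"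
    by (intro allI ip) auto
  then obtain b where b: "\<And>S j. norm (b S j) \<le> C"
    "\<And>S j n. n \<le> j \<Longrightarrow> n \<notin> S \<Longrightarrow> norm (a n + b S j) \<le> s"
    "\<And>S j n. n \<le> j \<Longrightarrow> n \<in> S \<Longrightarrow> r \<le> norm (a n + b S j)"
    by (metis DiffI IntI atMost_iff)
  \<comment> \<open>Equal codes would cost less than \<open>7 * \<delta>\<close> in all, well below
    the gap \<open>16 * \<delta>\<close>.\<close>
  define \<delta> where "\<delta> = (r - s) / 16"
  have \<delta>: "0 < \<delta>" using assms by (simp add: \<delta>_def)
  obtain L where L: "C / \<delta> < 2 ^ L" using real_arch_pow[of 2 "C / \<delta>"] by auto
  then have L: "C / 2 ^ L < \<delta>" using \<delta> by (simp add: field_simps)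
  obtain d where d: "\<And>S. coded \<delta> L (b S) (d S)"
    using coded_exists[of "b _", OF b(1) \<delta>] by metis
  have "S \<subseteq> S'" if "d S = d S'" for S S'
  proof (rule ccontr)
    assume "\<not> S \<subseteq> S'"
    then obtain n where "n \<in> S" "n \<notin> S'" by blast
    then have "r \<le> s + 6 * \<delta> + C / 2 ^ L"
      using same_code_close[of \<delta> L "b S" "d S" "b S'" C n r "a n" s] d[of S] d[of S'] that b \<delta> by auto
    moreover have "16 * \<delta> = r - s" by (simp add: \<delta>_def)
    ultimately show False using L assms by linarith
  qed
  then have "inj d" by (metis injI subset_antisym)
  then have "inj (\<lambda>S. to_nat (d S))" by (simp add: inj_def)
  then have "surj (inv (\<lambda>S :: nat set. to_nat (d S)))" by (rule inj_imp_surj_inv)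
  then show False using Cantors_theorem[of "UNIV :: nat set"] by (metis Pow_UNIV)
qed

section \<open>Transfer to the completion\<close>

lemma embed_add: "completion_embed x + completion_embed y = completion_embed (x + y)"
  by (simp add: linear_add linear_completion_embed)

lemma approximate_by_c00:
  fixes z :: tsirelson
  assumes "0 < e"
  obtains x where "norm (completion_embed x - z) < e" "norm x < norm z + e"
proof -
  obtain x where x: "norm (completion_embed x - z) < e"
    using completion_embed_dist_small[OF assms, of z] by (auto simp: dist_norm)
  moreover have "norm x < norm z + e"
    using x norm_triangle_ineq2[of "completion_embed x" z] by (simp add: norm_completion_embed)
  ultimately show thesis by (rule that)
qed

lemma norm_add_approx:
  fixes a b :: "'a::real_normed_vector"
  shows "\<bar>norm (a' + b') - norm (a + b)\<bar> \<le> norm (a' - a) + norm (b' - b)"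
  using norm_triangle_ineq3[of "a' + b'" "a + b"] norm_triangle_ineq[of "a' - a" "b' - b"]
  by (simp add: algebra_simps)

lemma tsirelson_NIP: "NIP_on (\<lambda>x y :: tsirelson. norm (x + y)) (cball 0 1)"
  unfolding NIP_on_def IP_on_def
proof clarify
  fix a :: "nat \<Rightarrow> tsirelson" and r s :: real
  assume "range a \<subseteq> cball 0 1" "s < r"
    and ip: "\<forall>E F. finite E \<and> finite F \<and> E \<inter> F = {} \<longrightarrow>
      (\<exists>b\<in>cball 0 1. (\<forall>n\<in>E. norm (a n + b) \<le> s) \<and> (\<forall>n\<in>F. r \<le> norm (a n + b)))"
  \<comment> \<open>Finitely supported approximations of \<open>a n\<close> and \<open>b\<close>
    move each norm by less than \<open>2 * e\<close>, so half of the gap survives; the ball grows to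
    radius \<open>1 + e\<close>.\<close>
  define e where "e = (r - s) / 8"
  have e: "0 < e" "8 * e = r - s" using \<open>s < r\<close> by (simp_all add: e_def)
  have "\<forall>n. \<exists>x. norm (completion_embed x - a n) < e"
    using approximate_by_c00[OF e(1)] by metis
  then obtain a' where a': "\<And>n. norm (completion_embed (a' n) - a n) < e" by metis
  have "s + 2 * e < r - 2 * e" using e by linarith
  then obtain E F where EF: "finite E" "finite F" "E \<inter> F = {}"
    and no: "\<And>b. norm b \<le> 1 + e \<Longrightarrow>
      (\<exists>n\<in>E. s + 2 * e < norm (a' n + b)) \<or> (\<exists>n\<in>F. norm (a' n + b) < r - 2 * e)"
    using not_independent_c00[of "s + 2 * e" "r - 2 * e" "1 + e" a'] by blast
  obtain b where b: "norm b \<le> 1" "\<forall>n\<in>E. norm (a n + b) \<le> s" "\<forall>n\<in>F. r \<le> norm (a n + b)"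
    using ip EF by (metis mem_cball_0)
  obtain b' where b': "norm (completion_embed b' - b) < e" "norm b' < norm b + e"
    by (rule approximate_by_c00[OF e(1)])
  have "\<bar>norm (a' n + b') - norm (a n + b)\<bar> < 2 * e" for n
    using norm_add_approx[of "completion_embed (a' n)" "completion_embed b'" "a n" b] a'[of n] b'(1)
    by (simp add: embed_add norm_completion_embed)
  then show False using no[of b'] b b'(2) by (smt (verit))
qed

section \<open>Unit vectors and averages\<close>

text \<open>The condition \<open>0 < i\<close> keeps the dummy coordinate \<open>0\<close> at
  zero.\<close>

lift_definition unit_vec :: "nat \<Rightarrow> tsirelson_c00" is "\<lambda>i k. if k = i \<and> 0 < i then 1 else 0"
  by (auto simp: finsupp_def)

lemma coord_unit_vec: "coord (unit_vec i) k = (if k = i \<and> 0 < i then 1 else 0)"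
  by transfer simp

lemma norm_unit_vec_le: "norm (unit_vec i) \<le> 1"
  using norm_le_sum_abs[of "{i}" "unit_vec i"] by (auto simp: coord_unit_vec proj_eq_self_iff split: if_splits)

section \<open>Spreading a vector to the right\<close>

definition move :: "nat \<Rightarrow> nat \<Rightarrow> tsirelson_c00 \<Rightarrow> tsirelson_c00" where
  "move i j x = x + coord x i *\<^sub>R (unit_vec j - unit_vec i)"

lemma coord_move:
  assumes "0 < i" "i < j" "\<And>k. i < k \<Longrightarrow> k \<le> j \<Longrightarrow> coord x k = 0"
  shows "coord (move i j x) k = (if k = j then coord x i else if k = i then 0 else coord x k)"
  using assms by (auto simp: move_def coord_simps coord_unit_vec)

text \<open>Minimality of the norm, with \<open>F\<close> the norm of the moved vector: each
  interval family for \<open>x\<close> becomes one for \<open>move i j x\<close> that starts no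
  earlier, so it stays admissible.\<close>

lemma norm_le_norm_move:
  assumes ij: "0 < i" "i < j" and x: "\<And>k. i < k \<Longrightarrow> k \<le> j \<Longrightarrow> coord x k = 0"
  shows "norm x \<le> norm (move i j x)"
proof (rule norm_le_functional[where P = "\<lambda>x. \<forall>k. i < k \<longrightarrow> k \<le> j \<longrightarrow> coord x k = 0"])
  have coord_move: "coord (move i j y) l = (if l = j then coord y i else if l = i then 0 else coord y l)"
    if "\<forall>k. i < k \<longrightarrow> k \<le> j \<longrightarrow> coord y k = 0" for y l
    by (rule coord_move[OF ij]) (use that in blast)
  show "\<forall>k. i < k \<longrightarrow> k \<le> j \<longrightarrow> coord x k = 0" using x by blast
  fix x assume P: "\<forall>k. i < k \<longrightarrow> k \<le> j \<longrightarrow> coord x k = 0"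
  then have P': "\<forall>k. i < k \<longrightarrow> k \<le> j \<longrightarrow> coord (proj A x) k = 0" for A
    by (simp add: coord_simps)
  show "\<forall>k. i < k \<longrightarrow> k \<le> j \<longrightarrow> coord (proj A x) k = 0" for A by (rule P')
  show "\<bar>coord x k\<bar> \<le> norm (move i j x)" for k
    using abs_coord_le_norm[of "move i j x" k] abs_coord_le_norm[of "move i j x" j] P ij
    by (cases "k = i"; cases "k = j") (simp_all add: coord_move[OF P])
  show "norm (move i j (proj A x)) \<le> norm (move i j x)" for A
  proof -
    have "move i j (proj A x) = proj ({k \<in> A. k \<noteq> i \<and> k \<noteq> j} \<union> {k. k = j \<and> i \<in> A}) (move i j x)"
      by (rule c00_eqI) (use ij in \<open>auto simp: coord_move[OF P] coord_move[OF P'] coord_proj\<close>)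
    then show ?thesis by (metis norm_proj_le)
  qed
  fix k :: nat and t :: "nat \<Rightarrow> nat" assume t: "mono t" "k \<le> t 0"
  \<comment> \<open>Endpoints after \<open>i\<close> and up to \<open>j\<close> jump past
    \<open>j\<close>: the interval that held \<open>i\<close> now holds \<open>j\<close>, and
    positions outside the range from \<open>i\<close> to \<open>j\<close> keep their
    intervals.\<close>
  define t' where "t' n = (if i < t n \<and> t n \<le> j then Suc j else t n)" for n
  have t_le: "t n \<le> t' n" for n by (simp add: t'_def)
  have "mono t'"
    unfolding mono_def
  proof (intro allI impI)
    fix m n :: nat assume "m \<le> n"
    then have "t m \<le> t n" by (rule monoD[OF t(1)])
    then show "t' m \<le> t' n" by (auto simp: t'_def)
  qed
  moreover have "k \<le> t' 0" using t(2) t_le[of 0] by linarith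
  moreover have "move i j (proj {t n..<t (Suc n)} x) = proj {t' n..<t' (Suc n)} (move i j x)" for n
  proof (rule c00_eqI)
    have j_iff: "j \<in> {t' n..<t' (Suc n)} \<longleftrightarrow> i \<in> {t n..<t (Suc n)}"
      using ij by (auto simp: t'_def)
    have other_iff: "l \<in> {t' n..<t' (Suc n)} \<longleftrightarrow> l \<in> {t n..<t (Suc n)}" if "l < i \<or> j < l" for l
      using that by (auto simp: t'_def)
    fix l
    consider "l = i" | "l = j" | "i < l" "l < j" | "l < i \<or> j < l" by linarith
    then show "coord (move i j (proj {t n..<t (Suc n)} x)) l = coord (proj {t' n..<t' (Suc n)} (move i j x)) l"
      unfolding coord_move[OF P] coord_move[OF P'] coord_proj
    proof cases
      case 3
      then have "coord x l = 0" using P by simp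
      then show "(if l = j then if i \<in> {t n..<t (Suc n)} then coord x i else 0
          else if l = i then 0 else if l \<in> {t n..<t (Suc n)} then coord x l else 0)
        = (if l \<in> {t' n..<t' (Suc n)} then if l = j then coord x i else if l = i then 0 else coord x l else 0)"
        using 3 by simp
    qed (use ij j_iff other_iff[of l] in \<open>auto simp del: atLeastLessThan_iff\<close>)
  qed
  ultimately show "(\<Sum>n<k. norm (move i j (proj {t n..<t (Suc n)} x))) \<le> 2 * norm (move i j x)"
    using interval_norm_sum_le[of t' k "move i j x"] by simp
qed

lemma norm_unit_vec_add_mono:
  assumes "0 < i" "i \<le> j" and u: "\<And>k. i \<le> k \<Longrightarrow> k \<le> j \<Longrightarrow> coord u k = 0"
  shows "norm (unit_vec i + u) \<le> norm (unit_vec j + u)"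
proof (cases "i = j")
  case False
  then have ij: "0 < i" "i < j" using assms by simp_all
  have zero: "coord (unit_vec i + u) k = 0" if "i < k" "k \<le> j" for k
    using that u by (simp add: coord_simps coord_unit_vec)
  have "move i j (unit_vec i + u) = unit_vec j + u"
    by (rule c00_eqI)
      (use ij u in \<open>auto simp: coord_move[OF ij zero] coord_simps coord_unit_vec\<close>)
  then show ?thesis using norm_le_norm_move[OF ij, of "unit_vec i + u"] zero by simp
qed simp

lemma exists_almost_mono_pair:
  assumes T: "mono T" "K \<le> T 0" "0 < K"
    and ij: "\<And>n. T n \<le> i n" "\<And>n. i n \<le> j n" "\<And>n. j n < T (Suc n)" "\<And>n. 0 < i n"
  shows "\<exists>n<K. norm (unit_vec (i n) + b) \<le> norm (unit_vec (j n) + b) + 4 * norm b / real K"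
proof -
  obtain n where n: "n < K" "norm (proj {T n..<T (Suc n)} b) \<le> 2 * norm b / real K"
    by (rule exists_small_block[OF T])
  \<comment> \<open>Without this block \<open>b\<close> vanishes from \<open>i n\<close> to
    \<open>j n\<close>, where the shift is monotone; the removal costs
    \<open>2 * norm b / real K\<close> for each of the two vectors.\<close>
  define b' where "b' = b - proj {T n..<T (Suc n)} b"
  have "norm (unit_vec (i n) + b') \<le> norm (unit_vec (j n) + b')"
  proof (rule norm_unit_vec_add_mono)
    show "coord b' k = 0" if "i n \<le> k" "k \<le> j n" for k
      using that ij(1,3)[of n] by (auto simp: b'_def coord_simps)
  qed (use ij in auto)
  moreover have "\<bar>norm (unit_vec m + b) - norm (unit_vec m + b')\<bar> \<le> 2 * norm b / real K" for m
    using norm_add_approx[of "unit_vec m" b "unit_vec m" b'] n(2) by (simp add: b'_def)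
  from this[of "i n"] this[of "j n"]
  have "norm (unit_vec (i n) + b) \<le> norm (unit_vec (i n) + b') + 2 * norm b / real K"
    "norm (unit_vec (j n) + b') \<le> norm (unit_vec (j n) + b) + 2 * norm b / real K"
    by linarith+
  moreover have "4 * norm b / real K = 2 * norm b / real K + 2 * norm b / real K" by simp
  ultimately show ?thesis using n(1) by (intro exI[of _ n]) linarith
qed

section \<open>Averages of unit vectors\<close>

lemma l1norm_interval_sum_le:
  assumes "mono t"
  shows "(\<Sum>i<k. l1norm (coord (proj {t i..<t (Suc i)} x))) \<le> l1norm (coord x)"
proof -
  define S where "S = {k. coord x k \<noteq> 0}"
  have finS: "finite S" using finsupp_coord[of x] by (simp add: S_def finsupp_def)
  have l1: "l1norm (coord (proj A x)) = (\<Sum>k\<in>A \<inter> S. \<bar>coord x k\<bar>)" for A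
  proof -
    have "{k. coord (proj A x) k \<noteq> 0} = A \<inter> S" by (auto simp: S_def coord_simps)
    then show ?thesis by (simp add: l1norm_def coord_simps)
  qed
  have "(\<Sum>i<k. l1norm (coord (proj {t i..<t (Suc i)} x))) \<le> (\<Sum>k\<in>{..<t k} \<inter> S. \<bar>coord x k\<bar>)"
  proof (induction k)
    case (Suc k)
    have "(\<Sum>l\<in>{..<t k} \<inter> S. \<bar>coord x l\<bar>) + (\<Sum>l\<in>{t k..<t (Suc k)} \<inter> S. \<bar>coord x l\<bar>)
        = (\<Sum>l\<in>({..<t k} \<inter> S) \<union> ({t k..<t (Suc k)} \<inter> S). \<bar>coord x l\<bar>)"
      using finS by (intro sum.union_disjoint[symmetric]) auto
    also have "({..<t k} \<inter> S) \<union> ({t k..<t (Suc k)} \<inter> S) = {..<t (Suc k)} \<inter> S"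
      using monoD[OF assms, of k "Suc k"] by auto
    finally show ?case using Suc l1[of "{t k..<t (Suc k)}"] by simp
  qed (simp add: sum_nonneg)
  also have "\<dots> \<le> l1norm (coord x)"
    unfolding l1norm_def S_def[symmetric] using finS by (intro sum_mono2) auto
  finally show ?thesis .
qed

text \<open>The l1 norm is additive over the disjoint members of a family, and the definition of the
  norm halves the sum.\<close>

lemma norm_le_half_l1norm:
  assumes "\<And>k. \<bar>coord x k\<bar> \<le> c" "l1norm (coord x) \<le> 2 * c"
  shows "norm x \<le> c"
proof (rule norm_least[OF assms(1)])
  fix k :: nat and t :: "nat \<Rightarrow> nat" assume "mono t"
  have "(\<Sum>i<k. norm (proj {t i..<t (Suc i)} x)) \<le> (\<Sum>i<k. l1norm (coord (proj {t i..<t (Suc i)} x)))"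
    by (intro sum_mono norm_le_l1norm)
  then show "(\<Sum>i<k. norm (proj {t i..<t (Suc i)} x)) \<le> 2 * c"
    using l1norm_interval_sum_le[OF \<open>mono t\<close>, of x k] assms(2) by linarith
qed

text \<open>The factor gives l1 norm 2 and, from \<open>n = 2\<close> on, a vector of the unit ball.
  The support begins at \<open>n + 1\<close>, which leaves room for its \<open>n\<close> singletons
  and one more member.\<close>

definition average :: "nat \<Rightarrow> tsirelson_c00" where
  "average n = (2 / real n) *\<^sub>R (\<Sum>i\<in>{n<..2 * n}. unit_vec i)"

lemma coord_average: "coord (average n) k = (if n < k \<and> k \<le> 2 * n then 2 / real n else 0)"
proof -
  have "(\<Sum>i\<in>{n<..2 * n}. coord (unit_vec i) k) = (\<Sum>i\<in>{n<..2 * n}. if i = k then 1 else 0)"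
    by (intro sum.cong) (auto simp: coord_unit_vec)
  then show ?thesis by (simp add: average_def coord_simps)
qed

lemma l1norm_average:
  assumes "0 < n"
  shows "l1norm (coord (average n)) = 2"
proof -
  have "{k. coord (average n) k \<noteq> 0} = {n<..2 * n}" using assms by (auto simp: coord_average)
  then have "l1norm (coord (average n)) = (\<Sum>k\<in>{n<..2 * n}. 2 / real n)"
    unfolding l1norm_def by (intro sum.cong) (auto simp: coord_average)
  then show ?thesis using assms by simp
qed

lemma norm_average_le: "2 \<le> n \<Longrightarrow> norm (average n) \<le> 1"
  by (rule norm_le_half_l1norm) (auto simp: coord_average l1norm_average)

text \<open>A family that meets \<open>m\<close> has at most \<open>m\<close> members. On the
  average each costs half its l1 norm plus at most \<open>2 / real n\<close>, a surplus of
  \<open>2 * real m / real n\<close> before halving. A family beyond \<open>m\<close> sees the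
  average alone.\<close>

lemma norm_unit_vec_add_average_le:
  assumes m: "0 < m" "m \<le> n" and n: "2 \<le> n"
  shows "norm (unit_vec m + average n) \<le> 1 + real m / real n"
proof (rule norm_least)
  show "\<bar>coord (unit_vec m + average n) k\<bar> \<le> 1 + real m / real n" for k
  proof -
    have "0 \<le> 2 / real n" "2 / real n \<le> 1" "0 \<le> real m / real n" using n by simp_all
    moreover have "coord (unit_vec m + average n) k \<in> {0, 1, 2 / real n}"
      using m by (simp add: coord_simps coord_unit_vec coord_average)
    ultimately show ?thesis by (smt (verit) insert_iff singletonD)
  qed
next
  fix k :: nat and t :: "nat \<Rightarrow> nat" assume t: "mono t" "k \<le> t 0"
  let ?I = "\<lambda>i. {t i..<t (Suc i)}"
  show "(\<Sum>i<k. norm (proj (?I i) (unit_vec m + average n))) \<le> 2 * (1 + real m / real n)"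
  proof (cases "m < t 0")
    case True
    have "proj (?I i) (unit_vec m + average n) = proj (?I i) (average n)" for i
      using True monoD[OF t(1), of 0 i]
      by (intro c00_eqI) (auto simp: coord_simps coord_unit_vec)
    then show ?thesis
      using interval_norm_sum_le[OF t, of "average n"] norm_average_le[OF n]
      by (simp add: add_increasing2)
  next
    case False
    have "norm (proj (?I i) (average n)) \<le> 2 / real n + l1norm (coord (proj (?I i) (average n))) / 2" for i
      by (rule norm_le_half_l1norm)
        (use l1norm_nonneg[of "coord (proj (?I i) (average n))"] in \<open>auto simp: coord_simps coord_average\<close>)
    then have "norm (proj (?I i) (unit_vec m + average n)) \<le> l1norm (coord (proj (?I i) (unit_vec m)))
        + (2 / real n + l1norm (coord (proj (?I i) (average n))) / 2)" for i
      unfolding proj_add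
      by (intro order_trans[OF norm_triangle_ineq] add_mono norm_le_l1norm)
    then have "(\<Sum>i<k. norm (proj (?I i) (unit_vec m + average n)))
        \<le> (\<Sum>i<k. l1norm (coord (proj (?I i) (unit_vec m)))
          + (2 / real n + l1norm (coord (proj (?I i) (average n))) / 2))"
      by (intro sum_mono)
    also have "\<dots> = (\<Sum>i<k. l1norm (coord (proj (?I i) (unit_vec m)))) + 2 * real k / real n
        + (\<Sum>i<k. l1norm (coord (proj (?I i) (average n)))) / 2"
      by (simp add: sum.distrib sum_divide_distrib)
    also have "\<dots> \<le> 1 + 2 * real m / real n + 1"
    proof (intro add_mono)
      have "{k. coord (unit_vec m) k \<noteq> 0} = {m}" using m(1) by (auto simp: coord_unit_vec)
      then have "l1norm (coord (unit_vec m)) = 1" using m(1) by (simp add: l1norm_def coord_unit_vec)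
      then show "(\<Sum>i<k. l1norm (coord (proj (?I i) (unit_vec m)))) \<le> 1"
        using l1norm_interval_sum_le[OF t(1), of "unit_vec m" k] by simp
      show "2 * real k / real n \<le> 2 * real m / real n"
        using False t(2) by (intro divide_right_mono) auto
      show "(\<Sum>i<k. l1norm (coord (proj (?I i) (average n)))) / 2 \<le> 1"
        using l1norm_interval_sum_le[OF t(1), of "average n" k] l1norm_average[of n] n by simp
    qed
    finally show ?thesis by simp
  qed
qed

lemma norm_unit_vec_add_average_ge:
  assumes m: "2 * n < m" and n: "0 < n"
  shows "3 / 2 \<le> norm (unit_vec m + average n)"
proof -
  \<comment> \<open>There are \<open>n + 1\<close> members from \<open>n + 1\<close> on: the
    singletons of the average, contributing 2, and an interval ending at \<open>m\<close>,
    contributing 1.\<close>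
  define t where "t i = (if i \<le> n then Suc n + i else Suc m)" for i
  let ?x = "unit_vec m + average n"
  have t: "mono t" using m by (auto simp: mono_def t_def)
  have "2 / real n \<le> norm (proj {t i..<t (Suc i)} ?x)" if "i < n" for i
    using abs_coord_le_norm[of "proj {t i..<t (Suc i)} ?x" "Suc n + i"] that m
    by (simp add: coord_simps coord_unit_vec coord_average t_def)
  then have "(\<Sum>i<n. 2 / real n) \<le> (\<Sum>i<n. norm (proj {t i..<t (Suc i)} ?x))"
    by (intro sum_mono) simp
  moreover have "1 \<le> norm (proj {t n..<t (Suc n)} ?x)"
    using abs_coord_le_norm[of "proj {t n..<t (Suc n)} ?x" m] m
    by (simp add: coord_simps coord_unit_vec coord_average t_def)
  ultimately have "3 \<le> (\<Sum>i<Suc n. norm (proj {t i..<t (Suc i)} ?x))" using n by simp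
  also have "\<dots> \<le> 2 * norm ?x" by (rule interval_norm_sum_le[OF t]) (simp add: t_def)
  finally show ?thesis by simp
qed

section \<open>The type space\<close>

lemma topspace_cube_bounds:
  "q \<in> topspace (cube_topology M) \<Longrightarrow> x \<in> M \<Longrightarrow> 0 \<le> q x \<and> q x \<le> 2"
  by (auto simp: cube_topology_def)

lemma type_space_subset: "topspace (type_space \<phi> M) \<subseteq> topspace (cube_topology M)"
  by (auto simp: type_space_def)

lemma compact_space_type_space: "compact_space (type_space \<phi> M)"
proof -
  have "compact_space (cube_topology M)"
    unfolding cube_topology_def compact_space_product_topology by (auto simp: compact_space_subtopology)
  then show ?thesis
    unfolding type_space_def
    by (intro compact_space_subtopology closedin_compact_space closedin_closure_of)
qed

lemma continuous_map_cube_eval: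
  assumes "x \<in> M"
  shows "continuous_map (cube_topology M) euclideanreal (\<lambda>q. q x)"
proof -
  have "continuous_map (cube_topology M) (top_of_set {0..2}) (\<lambda>q. q x)"
    unfolding cube_topology_def using assms by (rule continuous_map_product_projection)
  then show ?thesis by (simp add: continuous_map_in_subtopology)
qed

lemma continuous_map_type_space_eval:
  "x \<in> M \<Longrightarrow> continuous_map (type_space \<phi> M) euclideanreal (\<lambda>q. q x)"
  unfolding type_space_def by (rule continuous_map_from_subtopology[OF continuous_map_cube_eval])

lemma type_space_approx:
  assumes q: "q \<in> topspace (type_space \<phi> M)" and F: "finite F" "F \<subseteq> M" and "0 < e"
  shows "\<exists>b\<in>M. \<forall>x\<in>F. \<bar>\<phi> x b - q x\<bar> < e"
proof -
  let ?U = "\<lambda>x. {p \<in> topspace (cube_topology M). p x \<in> ball (q x) e}"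
  define V where "V = (\<Inter>x\<in>F. ?U x) \<inter> topspace (cube_topology M)"
  have "openin (cube_topology M) V"
    unfolding V_def
  proof (rule openin_INT[OF F(1)])
    show "openin (cube_topology M) (?U x)" if "x \<in> F" for x
      by (rule openin_continuous_map_preimage[OF continuous_map_cube_eval]) (use that F(2) in auto)
  qed
  moreover have "q \<in> V"
    using q \<open>0 < e\<close> type_space_subset[of \<phi> M] by (auto simp: V_def)
  ultimately obtain b where "b \<in> M" "(\<lambda>x\<in>M. \<phi> x b) \<in> V"
    using q by (auto simp: type_space_def in_closure_of)
  then show ?thesis
    using F(2) by (intro bexI[of _ b]) (auto simp: V_def dist_real_def abs_minus_commute subset_iff)
qed

lemma realised_type_in_type_space:
  assumes "b \<in> M" "\<And>x. x \<in> M \<Longrightarrow> 0 \<le> \<phi> x b \<and> \<phi> x b \<le> 2"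
  shows "(\<lambda>x\<in>M. \<phi> x b) \<in> topspace (type_space \<phi> M)"
proof -
  have "(\<lambda>x\<in>M. \<phi> x b) \<in> topspace (cube_topology M)"
    using assms(2) by (auto simp: cube_topology_def)
  then show ?thesis
    using assms(1) by (auto simp: type_space_def in_closure_of)
qed

text \<open>After an index that nearly attains the supremum of a tail, no term falls far below that
  supremum.\<close>

lemma almost_increasing_convergent:
  fixes Q :: "nat \<Rightarrow> real"
  assumes B: "\<And>n. Q n \<le> B"
    and Q: "\<And>e. 0 < e \<Longrightarrow> \<exists>M. \<forall>i j. M \<le> i \<longrightarrow> i < j \<longrightarrow> Q i \<le> Q j + e"
  shows "convergent Q"
proof -
  have "Cauchy Q"
  proof (rule metric_CauchyI)
    fix e :: real assume "0 < e"
    then obtain M where M: "\<And>i j. M \<le> i \<Longrightarrow> i < j \<Longrightarrow> Q i \<le> Q j + e / 4"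
      using Q[of "e / 4"] by auto
    have bdd: "bdd_above (Q ` {M..})" using B by (auto intro!: bdd_aboveI2)
    define g where "g = Sup (Q ` {M..})"
    obtain i where i: "M \<le> i" "g - e / 4 < Q i"
      using less_cSup_iff[OF _ bdd, of "g - e / 4"] \<open>0 < e\<close> by (auto simp: g_def)
    have "dist (Q m) (Q n) < e" if "m \<ge> Suc i" "n \<ge> Suc i" for m n
    proof -
      have "Q m \<le> g" "Q n \<le> g"
        unfolding g_def using that i(1) by (auto intro!: cSup_upper bdd)
      moreover have "g - e / 2 < Q m" "g - e / 2 < Q n"
        using M[OF i(1), of m] M[OF i(1), of n] that i(2) by auto
      ultimately show ?thesis by (auto simp: dist_real_def)
    qed
    then show "\<exists>M. \<forall>m\<ge>M. \<forall>n\<ge>M. dist (Q m) (Q n) < e" by blast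
  qed
  then show ?thesis by (rule Cauchy_convergent)
qed

section \<open>Failure of weak sequential completeness\<close>

definition basis :: "nat \<Rightarrow> tsirelson" where
  "basis n = completion_embed (unit_vec (Suc n))"

lemma basis_in_cball: "basis n \<in> cball 0 1"
  by (simp add: basis_def norm_completion_embed norm_unit_vec_le)

text \<open>A failure yields drops by more than \<open>e\<close> arbitrarily far out.
  \<open>K\<close> of them in successive blocks involve finitely many vectors, on which one element
  of the ball approximates \<open>q\<close>; for it \<open>exists_almost_mono_pair\<close> excludes
  one of the drops.\<close>

lemma type_at_basis_convergent:
  assumes q: "q \<in> topspace (type_space (\<lambda>x y :: tsirelson. norm (x + y)) (cball 0 1))"
  shows "convergent (\<lambda>n. q (basis n))"
proof (rule almost_increasing_convergent)
  show "q (basis n) \<le> 2" for n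
    using topspace_cube_bounds[of q "cball 0 1" "basis n"] q type_space_subset basis_in_cball by blast
  fix e :: real assume "0 < e"
  show "\<exists>M. \<forall>i j. M \<le> i \<longrightarrow> i < j \<longrightarrow> q (basis i) \<le> q (basis j) + e"
  proof (rule ccontr)
    assume "\<not> ?thesis"
    then have "\<forall>M. \<exists>i j. M \<le> i \<and> i < j \<and> q (basis j) + e < q (basis i)" by (meson not_le)
    then obtain I J where IJ: "\<And>M. M \<le> I M" "\<And>M. I M < J M" "\<And>M. q (basis (J M)) + e < q (basis (I M))"
      by metis
    \<comment> \<open>With \<open>norm b'\<close> at most 2, the error
      \<open>4 * norm b' / real K\<close> is below \<open>e / 4\<close>; the two approximations cost
      \<open>e / 4\<close> each.\<close>
    obtain K where K: "real K > 32 / e" using reals_Archimedean2 by blast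
    then have "0 < K" using \<open>0 < e\<close> by (metis divide_pos_pos less_trans of_nat_0_less_iff zero_less_numeral)
    \<comment> \<open>One successor for the shift in \<open>basis\<close>, one because the blocks
      are half-open.\<close>
    define T where "T = rec_nat K (\<lambda>_ m. Suc (Suc (J m)))"
    have T: "T 0 = K" "T (Suc n) = Suc (Suc (J (T n)))" for n by (simp_all add: T_def)
    have "T n \<le> T (Suc n)" for n using IJ(1,2)[of "T n"] by (simp add: T)
    then have "mono T" by (simp add: mono_iff_le_Suc)
    define F where "F = (\<lambda>n. basis (I (T n))) ` {..<K} \<union> (\<lambda>n. basis (J (T n))) ` {..<K}"
    have "finite F" "F \<subseteq> cball 0 1" using basis_in_cball unfolding F_def by blast+
    then obtain b where b: "b \<in> cball 0 1" "\<forall>x\<in>F. \<bar>norm (x + b) - q x\<bar> < e / 8"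
      using type_space_approx[OF q, of F "e / 8"] \<open>0 < e\<close> by auto
    obtain b' where b': "norm (completion_embed b' - b) < min 1 (e / 8)" "norm b' < norm b + min 1 (e / 8)"
      using approximate_by_c00[of "min 1 (e / 8)" b] \<open>0 < e\<close> by auto
    have close: "\<bar>norm (unit_vec (Suc i) + b') - q (basis i)\<bar> < e / 4" if "basis i \<in> F" for i
    proof -
      have "norm (basis i + completion_embed b') = norm (unit_vec (Suc i) + b')"
        by (simp add: basis_def embed_add norm_completion_embed)
      then have "\<bar>norm (unit_vec (Suc i) + b') - norm (basis i + b)\<bar> < e / 8"
        using norm_add_approx[of "basis i" "completion_embed b'" "basis i" b] b'(1) by simp
      then show ?thesis using bspec[OF b(2) that] by linarith
    qed
    have "\<exists>n<K. norm (unit_vec (Suc (I (T n))) + b')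
        \<le> norm (unit_vec (Suc (J (T n))) + b') + 4 * norm b' / real K"
      by (rule exists_almost_mono_pair[OF \<open>mono T\<close> _ \<open>0 < K\<close>])
        (simp_all add: T IJ(1) IJ(2) le_SucI less_imp_le)
    then obtain n where n: "n < K"
      "norm (unit_vec (Suc (I (T n))) + b') \<le> norm (unit_vec (Suc (J (T n))) + b') + 4 * norm b' / real K"
      by blast
    have "4 * norm b' / real K \<le> 8 / real K" using b(1) b'(2) by (intro divide_right_mono) auto
    also have "8 / real K < e / 4" using K \<open>0 < K\<close> \<open>0 < e\<close> by (simp add: field_simps)
    finally have "4 * norm b' / real K < e / 4" .
    moreover have "basis (I (T n)) \<in> F" "basis (J (T n)) \<in> F" using n(1) by (auto simp: F_def)
    ultimately show False
      using close[of "I (T n)"] close[of "J (T n)"] n(2) IJ(3)[of "T n"] by linarith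
  qed
qed

text \<open>Compactness replaces a cluster point of the averages: were \<open>g\<close> continuous,
  the sets \<open>C N\<close> would be closed, and a type in all of them would be at most 1 along
  the whole basis with limit at least 3/2.\<close>

lemma tsirelson_not_weakly_seq_complete: "\<not> weakly_seq_complete_on (\<lambda>x y :: tsirelson. norm (x + y)) (cball 0 1)"
proof
  let ?X = "type_space (\<lambda>x y :: tsirelson. norm (x + y)) (cball 0 1)"
  assume wsc: "weakly_seq_complete_on (\<lambda>x y :: tsirelson. norm (x + y)) (cball 0 1)"
  define g where "g q = lim (\<lambda>n. q (basis n))" for q :: "tsirelson \<Rightarrow> real"
  have lim: "(\<lambda>n. q (basis n)) \<longlonglongrightarrow> g q" if "q \<in> topspace ?X" for q
    using type_at_basis_convergent[OF that] by (simp add: g_def convergent_LIMSEQ_iff)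
  have "range basis \<subseteq> cball 0 1" using basis_in_cball by blast
  then have g: "continuous_map ?X euclideanreal g"
    using wsc lim unfolding weakly_seq_complete_on_def by blast
  \<comment> \<open>The average of index \<open>N + 2\<close> will lie in \<open>C N\<close>: this
    index is at least 2 and at least \<open>Suc m\<close> for \<open>m \<le> N\<close>, as the upper
    estimate requires.\<close>
  define C where "C N = {q \<in> topspace ?X. g q \<in> {3/2..}} \<inter>
    (\<Inter>m\<in>{..N}. {q \<in> topspace ?X. q (basis m) \<in> {..1 + real (Suc m) / real (N + 2)}})" for N
  have "(\<Inter>N. C N) \<noteq> {}"
  proof (rule compact_space_imp_nest[OF compact_space_type_space])
    show "closedin ?X (C N)" for N
      unfolding C_def
      by (intro closedin_Int closedin_INT closedin_continuous_map_preimage[OF g]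
          closedin_continuous_map_preimage[OF continuous_map_type_space_eval] basis_in_cball) auto
    show "C N \<noteq> {}" for N
    proof -
      let ?b = "completion_embed (average (N + 2))"
      let ?q = "\<lambda>x\<in>cball 0 1. norm (x + ?b)"
      have b: "norm ?b \<le> 1" using norm_average_le[of "N + 2"] by (simp add: norm_completion_embed)
      have q: "?q \<in> topspace ?X"
      proof (rule realised_type_in_type_space)
        show "0 \<le> norm (x + ?b) \<and> norm (x + ?b) \<le> 2" if "x \<in> cball 0 1" for x
          using that b norm_triangle_ineq[of x ?b] by auto
      qed (use b in simp)
      have q_basis: "?q (basis m) = norm (unit_vec (Suc m) + average (N + 2))" for m
        using basis_in_cball[of m] by (simp add: basis_def embed_add norm_completion_embed)
      have "3 / 2 \<le> g ?q"
      proof (rule LIMSEQ_le_const[OF lim[OF q]], intro exI allI impI)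
        show "3 / 2 \<le> ?q (basis m)" if "2 * (N + 2) \<le> m" for m
          unfolding q_basis using that by (intro norm_unit_vec_add_average_ge) auto
      qed
      moreover have "?q (basis m) \<le> 1 + real (Suc m) / real (N + 2)" if "m \<le> N" for m
        unfolding q_basis using that by (intro norm_unit_vec_add_average_le) auto
      ultimately have "?q \<in> C N" using q by (simp add: C_def)
      then show ?thesis by blast
    qed
    show "decseq C"
    proof (rule decseq_SucI)
      show "C (Suc N) \<subseteq> C N" for N
      proof
        fix p assume p: "p \<in> C (Suc N)"
        have "p (basis m) \<le> 1 + real (Suc m) / real (N + 2)" if "m \<le> N" for m
        proof -
          have "p (basis m) \<le> 1 + real (Suc m) / real (Suc N + 2)"
            using p that by (auto simp: C_def)
          also have "\<dots> \<le> 1 + real (Suc m) / real (N + 2)"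
            by (intro add_left_mono divide_left_mono) auto
          finally show ?thesis .
        qed
        then show "p \<in> C N" using p by (auto simp: C_def)
      qed
    qed
  qed
  then obtain q where q: "\<And>N. q \<in> C N" by blast
  then have X: "q \<in> topspace ?X" and "3 / 2 \<le> g q" by (auto simp: C_def)
  have "q (basis m) \<le> 1" for m
  proof (rule LIMSEQ_le_const)
    show "(\<lambda>N. 1 + real (Suc m) / real (N + 2)) \<longlonglongrightarrow> 1"
      using tendsto_add[OF tendsto_const LIMSEQ_ignore_initial_segment[OF lim_const_over_n, of "real (Suc m)" 2], of 1]
      by simp
    show "\<exists>M. \<forall>N\<ge>M. q (basis m) \<le> 1 + real (Suc m) / real (N + 2)"
      using q by (intro exI[of _ m]) (auto simp: C_def)
  qed
  then have "g q \<le> 1" by (intro LIMSEQ_le_const2[OF lim[OF X]]) blast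
  with \<open>3 / 2 \<le> g q\<close> show False by simp
qed

theorem corollary4p19:
  shows "NIP_on (\<lambda>x y :: tsirelson. norm (x + y)) (cball 0 1) \<and>
    \<not> weakly_seq_complete_on (\<lambda>x y :: tsirelson. norm (x + y)) (cball 0 1)"
  using tsirelson_NIP tsirelson_not_weakly_seq_complete by blast

end
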